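(* Let $n\ge1$, $0<p<1$, $\nu\in\mathbb{R}$, $\sigma\in J_n^+$, and let $V(x,t)=\zeta(t)(1+t)^\nu|x|^\sigma$ where $\zeta>0$ is continuous with $\lim_{t\to\infty}t^\delta\zeta(t)=\infty$ and $\lim_{t\to\infty}t^{-\delta}\zeta(t)=0$ for every $\delta>0$, and, in case $\sigma>0$, $\zeta(t)(1+t)^\nu\in\mathcal{E}_\varepsilon$ for some $\varepsilon\in(0,1)$. Let $a=a_c=\frac{\sigma+2(\nu+1)_+}{1-p}$ and let $u_0\ge0$ be continuous with $\liminf_{|x|\to\infty}|x|^{-a}u_0(x)=l_1$, $\limsup_{|x|\to\infty}|x|^{-a}u_0(x)=l_2$, $l_1,l_2\in(0,\infty)$. Let $u$ be the global s-solution of $\partial_tu-\Delta\partial_tu=\Delta u+Vu^p$, $u(\cdot,0)=u_0$, and fix $R>0$. Then there is $\underline C>0$ and, for every $\varepsilon'>0$, a constant $\overline C_{\varepsilon'}>0$ such that $$\underline C\,l_1\,t^{a/2}\le\|u(\cdot,t)\|_{R,a}\le\overline C_{\varepsilon'}\,l_2\,t^{a/2+\varepsilon'}\quad\text{for all sufficiently large }t.$$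
   Context: $J_n^+=\{0\}\cup[1,\infty)$ if $n=1$, $[0,\infty)$ if $n\ge2$; $s_+=\max\{s,0\}$. $\|\varphi\|_{R,a}=\sup_x(R^2+|x|^2)^{-a/2}|\varphi(x)|$. $\mathcal{E}_\varepsilon$ is the set of continuous positive $\Lambda$ for which there are $c,t_0>0$ with $\int_0^{\varepsilon t}\Lambda\ge c\int_0^t\Lambda$ for all $t\ge t_0/\varepsilon$. $\mathcal{B}\varphi=B*\varphi$ with $B=\mathcal{F}^{-1}((1+|\xi|^2)^{-1})$. A global s-solution is $u\ge0$ with $\mu=e^tu\in C([0,\infty);BC_{a})$ ($BC_a$: continuous functions bounded by $C|x|^{a}$ at infinity) and $\mu(t)=u_0+\int_0^t\mathcal{B}\mu\,d\tau+\int_0^te^{(1-p)\tau}\mathcal{B}[V\mu^p]\,d\tau$; it exists and is unique under these hypotheses. *)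

theory Defs
  imports "HOL-Analysis.Analysis"
begin

definition Jplus :: "nat \<Rightarrow> real set" where
  "Jplus n = (if n = 1 then {0} \<union> {1..} else {0..})"

definition wnorm :: "real \<Rightarrow> real \<Rightarrow> ('a::real_normed_vector \<Rightarrow> real) \<Rightarrow> real" where
  "wnorm R a \<phi> = (SUP x. (R\<^sup>2 + (norm x)\<^sup>2) powr (-a/2) * \<bar>\<phi> x\<bar>)"

definition BC :: "real \<Rightarrow> ('a::real_normed_vector \<Rightarrow> real) set" where
  "BC a = {\<phi>. continuous_on UNIV \<phi> \<and>
     (\<exists>C r. \<forall>x. norm x \<ge> r \<longrightarrow> \<bar>\<phi> x\<bar> \<le> C * norm x powr a)}"

definition Eclass :: "real \<Rightarrow> (real \<Rightarrow> real) set" where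
  "Eclass \<epsilon> = {\<Lambda>. continuous_on {0..} \<Lambda> \<and> (\<forall>t\<ge>0. \<Lambda> t > 0) \<and>
     (\<exists>c t0. c > 0 \<and> t0 > 0 \<and> (\<forall>t\<ge>t0/\<epsilon>.
        integral {0..\<epsilon>*t} \<Lambda> \<ge> c * integral {0..t} \<Lambda>))}"

text \<open>Kernel B = F^{-1}((1+|xi|^2)^{-1}) (Bessel potential of order 2), written
  via the subordination formula B(x) = int_0^infty e^{-s} (4 pi s)^{-n/2} e^{-|x|^2/(4s)} ds.\<close>
definition Bker :: "(real, 'n::finite) vec \<Rightarrow> real" where
  "Bker x = integral {0<..} (\<lambda>s. exp (-s) * (4 * pi * s) powr (- real (CARD('n)) / 2)
                 * exp (- (norm x)\<^sup>2 / (4 * s)))"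

definition Bop :: "(real^'n::finite \<Rightarrow> real) \<Rightarrow> real^'n \<Rightarrow> real" where
  "Bop \<phi> x = integral UNIV (\<lambda>y. Bker (x - y) * \<phi> y)"

text \<open>Global s-solution of  u_t - Lap u_t = Lap u + V u^p, u(0)=u0;
  u t x is the value at time t, position x; mu t = e^t u t.\<close>
definition global_s_solution ::
  "real \<Rightarrow> real \<Rightarrow> (real^'n::finite \<Rightarrow> real \<Rightarrow> real) \<Rightarrow> (real^'n \<Rightarrow> real)
     \<Rightarrow> (real \<Rightarrow> real^'n \<Rightarrow> real) \<Rightarrow> bool" where
  "global_s_solution p a V u0 u \<longleftrightarrow>
     (let \<mu> = (\<lambda>t x. exp t * u t x) in
       (\<forall>t\<ge>0. \<forall>x. u t x \<ge> 0) \<and>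
       (\<forall>t\<ge>0. \<mu> t \<in> BC a) \<and>
       (\<forall>t0\<ge>0. ((\<lambda>t. wnorm 1 a (\<lambda>x. \<mu> t x - \<mu> t0 x)) \<longlongrightarrow> 0) (at t0 within {0..})) \<and>
       (\<forall>t\<ge>0. \<forall>x. \<mu> t x = u0 x + integral {0..t} (\<lambda>\<tau>. Bop (\<mu> \<tau>) x)
            + integral {0..t} (\<lambda>\<tau>. exp ((1-p)*\<tau>) * Bop (\<lambda>y. V y \<tau> * (\<mu> \<tau> y) powr p) x)))"

end

theory Submission
  imports Defs "HOL-Probability.Probability"
begin

text \<open>
  \<open>B\<close> is convolution with a symmetric probability density all of whose moments are finite, so for an
  integer \<open>m\<close> a Taylor expansion gives \<open>B Q\<^sup>m \<le> Q\<^sup>m + K Q\<^sup>m\<^sup>-\<^sup>1\<close> with \<open>Q = s + |x|\<^sup>2\<close>, \<open>s \<ge> 1\<close>. Concavity of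
  \<open>z \<mapsto> z powr \<theta>\<close>, \<open>\<theta> \<le> 1\<close>, extends this to real exponents, and hence \<open>(1 + k t + |x|\<^sup>2) powr b\<close> is a
  supersolution of the linear equation.

  Upper bound: because \<open>a = a\<^sub>c\<close>, the function \<open>A (1 + t) powr \<epsilon> * (1 + k t + |x|\<^sup>2) powr (a/2)\<close> is a
  supersolution of the nonlinear equation for large \<open>A\<close>; the factor \<open>(1 + t) powr \<epsilon>\<close> absorbs \<open>\<zeta>\<close>.

  Lower bound: drop the nonlinear term and compare on \<open>[0, T]\<close> with a multiple of
  \<open>|x|\<^sup>2 + m2 t - \<delta> T - (1 + k t + |x|\<^sup>2)\<^sup>2 / (L T)\<close>, where \<open>m2\<close> is the second moment of the kernel. It
  lies below \<open>u0\<close> at time 0 and is of order \<open>T powr (a/2)\<close> at \<open>x = 0\<close>, \<open>t = T\<close>.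

  Both comparisons reduce to one linear integral inequality \<open>d \<ge> \<integral> g\<close>, iterated to give \<open>d \<ge> 0\<close>.
\<close>

section \<open>The Bessel kernel\<close>

text \<open>The exponent reflects diffusive scaling. Put Q = 1 + k t + |x|^2, b = a/2 and z = F(t)
  Q^b. The source V z^p is at most \<zeta> F^p / (1 + t) times Q to the power \<sigma>/2 + b p +
  (\<nu> + 1)_+, and a is critical because this power is b again. Relative to z the source then has
  size \<zeta> F^(p-1) / (1 + t), to be compared with F'/F = \<epsilon> / (1 + t) for a power F of 1
  + t; since p < 1, a large amplitude makes the latter win. The lower bound can do without the
  source because data of size |x|^a have the value T^(a/2) at distance sqrt T, and diffusion carries
  it to the origin by time T. Pointwise information on B is awkward: the kernel is singular at the
  origin for n \<ge> 2 and has no scale invariance. Only mass, symmetry and moments of B are used,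
  which is why both barriers are built from powers of s + |x|^2 and the lower one is a polynomial in
  |x|^2, with an exact second-moment identity for its leading growth.\<close>

definition heat_kernel :: "real \<Rightarrow> real^'n::finite \<Rightarrow> real" where
  "heat_kernel s y = (4 * pi * s) powr (- real CARD('n) / 2) * exp (- (norm y)\<^sup>2 / (4 * s))"

lemma heat_kernel_nonneg: "0 \<le> heat_kernel s y"
  by (simp add: heat_kernel_def)

lemma heat_kernel_measurable [measurable]:
  "(\<lambda>(s, y). heat_kernel s (y :: real^'n::finite)) \<in> borel_measurable (lborel \<Otimes>\<^sub>M lborel)"
  unfolding heat_kernel_def by measurable

text \<open>The Gaussian factorises over coordinates into centred normal densities of variance
  \<open>2 * s\<close>, each of mass one.\<close>

lemma nn_integral_heat_kernel:
  assumes s: "s > 0"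
  shows "(\<integral>\<^sup>+ y. ennreal (heat_kernel s (y :: real^'n::finite)) \<partial>lborel) = 1"
proof -
  define f where "f = normal_density 0 (sqrt (2 * s))"
  have f: "f r = (4 * pi * s) powr (- 1 / 2) * exp (- r\<^sup>2 / (4 * s))" for r
    using s by (simp add: f_def normal_density_def powr_minus powr_half_sqrt real_sqrt_mult divide_simps)
  have prod: "heat_kernel s y = (\<Prod>b\<in>Basis. f (y \<bullet> b))" for y :: "real^'n"
  proof -
    have "(\<Prod>b\<in>(Basis :: (real^'n) set). f (y \<bullet> b)) =
        ((4 * pi * s) powr (- 1 / 2)) ^ CARD('n) * exp (\<Sum>b\<in>Basis. - (y \<bullet> b)\<^sup>2 / (4 * s))"
      by (simp add: f prod.distrib exp_sum)
    also have "((4 * pi * s) powr (- 1 / 2)) ^ CARD('n) = (4 * pi * s) powr (- real CARD('n) / 2)"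
      using s by (subst powr_realpow [symmetric]) (auto simp: powr_powr)
    also have "(\<Sum>b\<in>Basis. - (y \<bullet> b)\<^sup>2 / (4 * s)) = - (norm y)\<^sup>2 / (4 * s)"
    proof -
      have "(norm y)\<^sup>2 = (\<Sum>b\<in>Basis. (y \<bullet> b)\<^sup>2)"
        unfolding power2_norm_eq_inner using euclidean_inner [of y y] by (simp add: power2_eq_square)
      then show ?thesis by (simp add: sum_negf sum_divide_distrib)
    qed
    finally show ?thesis by (simp add: heat_kernel_def)
  qed
  have int1: "(\<integral>\<^sup>+ r. ennreal (f r) \<partial>lborel) = 1"
  proof -
    interpret prob_space "density lborel (\<lambda>r. ennreal (f r))"
      unfolding f_def using s by (intro prob_space_normal_density) simp
    show ?thesis using emeasure_space_1 by (simp add: emeasure_density f_def)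
  qed
  have "(\<integral>\<^sup>+ y. ennreal (heat_kernel s (y :: real^'n)) \<partial>lborel)
      = (\<integral>\<^sup>+ y. (\<Prod>b\<in>Basis. ennreal (f (y \<bullet> b))) \<partial>(lborel :: (real^'n) measure))"
    by (simp add: prod prod_ennreal f_def)
  also have "\<dots> = (\<Prod>b\<in>(Basis :: (real^'n) set). (\<integral>\<^sup>+ r. ennreal (f r) \<partial>lborel))"
    by (rule nn_integral_lborel_prod) (auto simp: f_def)
  finally show ?thesis by (simp add: int1)
qed

text \<open>Half of the Gaussian exponent absorbs the polynomial, by
  \<open>z ^ k \<le> fact k * exp z\<close> at z = |y|^2 / (8 s); the other half is the Gaussian at
  time \<open>2 * s\<close>. Only \<open>s ^ k\<close> is left over, which is integrable against the
  weight \<open>exp (- s)\<close> of the subordination formula.\<close>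

lemma power_times_heat_kernel_le:
  assumes s: "s > 0"
  shows "(norm y ^ 2) ^ k * heat_kernel s (y :: real^'n::finite)
    \<le> (fact k * 8 ^ k * 2 powr (real CARD('n) / 2)) * (s ^ k * heat_kernel (2 * s) y)"
proof -
  define z where "z = (norm y)\<^sup>2 / (8 * s)"
  have z: "z \<ge> 0" using s by (simp add: z_def)
  have "z ^ k / fact k \<le> exp z"
  proof -
    have "(\<Sum>n\<in>{k}. z ^ n /\<^sub>R fact n) \<le> (\<Sum>n. z ^ n /\<^sub>R fact n)"
      using z by (intro sum_le_suminf summable_exp_generic) auto
    then show ?thesis by (simp add: exp_def divide_inverse mult.commute)
  qed
  then have "z ^ k * exp (- (2 * z)) \<le> (fact k * exp z) * exp (- (2 * z))"
    by (intro mult_right_mono) (simp_all add: field_simps)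
  also have "\<dots> = fact k * exp (- z)"
    by (simp add: mult_exp_exp)
  finally have zk: "z ^ k * exp (- (2 * z)) \<le> fact k * exp (- z)" .
  have "(norm y ^ 2) ^ k = (8 * s) ^ k * z ^ k"
    using s by (simp add: z_def power_divide)
  moreover have "heat_kernel s y = (4 * pi * s) powr (- real CARD('n) / 2) * exp (- (2 * z))"
    using s by (simp add: heat_kernel_def z_def)
  moreover have "heat_kernel (2 * s) y * 2 powr (real CARD('n) / 2) = (4 * pi * s) powr (- real CARD('n) / 2) * exp (- z)"
  proof -
    have "(4 * pi * (2 * s)) powr (- real CARD('n) / 2) * 2 powr (real CARD('n) / 2)
       = (4 * pi * s) powr (- real CARD('n) / 2) * (2 powr (- real CARD('n) / 2) * 2 powr (real CARD('n) / 2))"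
      using powr_mult [of "4 * pi * s" 2 "- real CARD('n) / 2"] s by (simp add: mult_ac)
    also have "2 powr (- real CARD('n) / 2) * 2 powr (real CARD('n) / 2) = (1 :: real)"
      by (simp add: powr_add [symmetric])
    finally show ?thesis by (simp add: heat_kernel_def z_def mult_ac)
  qed
  ultimately have 1: "(norm y ^ 2) ^ k * heat_kernel s y
      = ((8 * s) ^ k * (4 * pi * s) powr (- real CARD('n) / 2)) * (z ^ k * exp (- (2 * z)))"
    and 2: "(fact k * 8 ^ k * 2 powr (real CARD('n) / 2)) * (s ^ k * heat_kernel (2 * s) y)
      = ((8 * s) ^ k * (4 * pi * s) powr (- real CARD('n) / 2)) * (fact k * exp (- z))"
    by (simp_all add: mult_ac power_mult_distrib)
  show ?thesis
    unfolding 1 2 using zk s by (intro mult_left_mono) auto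
qed

text \<open>Valued in \<open>ennreal\<close> so that Tonelli applies before any finiteness is known;
  at the origin the value is infinite when n \<ge> 2.\<close>

definition Bker_nn :: "real^'n::finite \<Rightarrow> ennreal" where
  "Bker_nn y = (\<integral>\<^sup>+ s. ennreal (exp (- s) * heat_kernel s y) * indicator {0<..} s \<partial>lborel)"

lemma Bker_nn_measurable [measurable]: "Bker_nn \<in> borel_measurable borel"
  unfolding Bker_nn_def heat_kernel_def by measurable

text \<open>This also holds where the defining integral of \<open>Bker\<close> diverges (the origin, in dimension at least 2):
  both sides are then 0 by convention.\<close>

lemma Bker_eq_enn2real: "Bker y = enn2real (Bker_nn (y :: real^'n::finite))"
proof -
  define f where "f = (\<lambda>s. exp (- s) * heat_kernel s y)"
  have fm [measurable]: "f \<in> borel_measurable borel"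
    unfolding f_def heat_kernel_def by measurable
  have f0: "f s \<ge> 0" for s by (simp add: f_def heat_kernel_nonneg)
  have "Bker y = integral {0<..} f"
    by (simp add: Bker_def f_def heat_kernel_def mult_ac)
  also have "\<dots> = (LINT s:{0<..}|lebesgue. f s)"
  proof (cases "set_integrable lebesgue {0<..} f")
    case True
    then show ?thesis by (simp add: set_lebesgue_integral_eq_integral)
  next
    case False
    then have "\<not> f integrable_on {0<..}"
      using absolutely_integrable_on_iff_nonneg [of "{0<..}" f] f0 by auto
    with False show ?thesis
      by (simp add: not_integrable_integral set_integrable_def set_lebesgue_integral_def not_integrable_integral_eq)
  qed
  also have "\<dots> = integral\<^sup>L lborel (\<lambda>s. indicator {0<..} s *\<^sub>R f s)"
    unfolding set_lebesgue_integral_def by (rule integral_completion) measurable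
  also have "\<dots> = enn2real (\<integral>\<^sup>+ s. ennreal (indicator {0<..} s *\<^sub>R f s) \<partial>lborel)"
    by (rule integral_eq_nn_integral) (auto simp: f0)
  also have "(\<integral>\<^sup>+ s. ennreal (indicator {0<..} s *\<^sub>R f s) \<partial>lborel) = Bker_nn y"
    unfolding Bker_nn_def f_def by (intro nn_integral_cong) (auto simp: indicator_def)
  finally show ?thesis .
qed

lemma Bker_nonneg: "Bker y \<ge> 0"
  by (simp add: Bker_eq_enn2real)

lemma Bker_measurable [measurable]: "Bker \<in> borel_measurable borel"
  unfolding Bker_eq_enn2real [abs_def] by measurable

text \<open>Tonelli: an integral against B is a Gaussian integral averaged over an exponentially
  distributed time. Mass and moments of B are both obtained this way.\<close>

lemma nn_integral_Bker_nn_mult: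
  fixes g :: "real^'n::finite \<Rightarrow> ennreal"
  assumes [measurable]: "g \<in> borel_measurable borel"
  shows "(\<integral>\<^sup>+ y. Bker_nn y * g y \<partial>lborel) =
    (\<integral>\<^sup>+ s. (ennreal (exp (- s)) * indicator {0<..} s) * (\<integral>\<^sup>+ y. ennreal (heat_kernel s y) * g y \<partial>lborel) \<partial>lborel)"
proof -
  have [measurable]: "(\<lambda>y. heat_kernel s (y :: real^'n)) \<in> borel_measurable borel" for s
    unfolding heat_kernel_def by measurable
  have [measurable]: "(\<lambda>s. heat_kernel s (y :: real^'n)) \<in> borel_measurable borel" for y
    unfolding heat_kernel_def by measurable
  have "(\<integral>\<^sup>+ y. Bker_nn y * g y \<partial>lborel)
      = (\<integral>\<^sup>+ y. (\<integral>\<^sup>+ s. ennreal (exp (- s)) * indicator {0<..} s * (ennreal (heat_kernel s y) * g y) \<partial>lborel) \<partial>lborel)"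
    unfolding Bker_nn_def
    by (subst nn_integral_multc [symmetric], measurable)
       (intro nn_integral_cong, simp add: ennreal_mult heat_kernel_nonneg mult_ac)
  also have "\<dots> = (\<integral>\<^sup>+ s. (\<integral>\<^sup>+ y. ennreal (exp (- s)) * indicator {0<..} s * (ennreal (heat_kernel s y) * g y) \<partial>lborel) \<partial>lborel)"
    by (rule lborel_pair.Fubini') (use heat_kernel_measurable in measurable)
  also have "\<dots> = (\<integral>\<^sup>+ s. (ennreal (exp (- s)) * indicator {0<..} s) * (\<integral>\<^sup>+ y. ennreal (heat_kernel s y) * g y \<partial>lborel) \<partial>lborel)"
    by (subst nn_integral_cmult) measurable
  finally show ?thesis .
qed

lemma nn_integral_Bker_nn: "(\<integral>\<^sup>+ y. Bker_nn (y :: real^'n::finite) \<partial>lborel) = 1"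
proof -
  have "(\<integral>\<^sup>+ y. Bker_nn (y :: real^'n) \<partial>lborel)
      = (\<integral>\<^sup>+ s. (ennreal (exp (- s)) * indicator {0<..} s) * (\<integral>\<^sup>+ y. ennreal (heat_kernel s (y :: real^'n)) \<partial>lborel) \<partial>lborel)"
    using nn_integral_Bker_nn_mult [of "\<lambda>_. 1"] by simp
  also have "\<dots> = (\<integral>\<^sup>+ s. ennreal (s ^ 0 * exp (- s)) * indicator {0..} s \<partial>lborel)"
  proof (rule nn_integral_cong_AE)
    \<comment> \<open>The Gamma integral is taken over the closed half-line; the point s = 0 is
      null.\<close>
    show "AE s in lborel. (ennreal (exp (- s)) * indicator {0<..} s) * (\<integral>\<^sup>+ y. ennreal (heat_kernel s (y :: real^'n)) \<partial>lborel)
        = ennreal (s ^ 0 * exp (- s)) * indicator {0..} s"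
      using AE_lborel_singleton [of "0 :: real"]
      by eventually_elim (auto simp: indicator_def nn_integral_heat_kernel)
  qed
  also have "\<dots> = 1"
    by (subst nn_intergal_power_times_exp_Ici) simp
  finally show ?thesis .
qed

text \<open>Finite total mass excludes the value infinity outside a null set, so replacing
  \<open>Bker_nn\<close> by the real-valued \<open>Bker\<close> changes no integral.\<close>

lemma Bker_nn_finite: "AE y in lborel. Bker_nn (y :: real^'n::finite) = ennreal (Bker y)"
proof -
  have "AE y in lborel. Bker_nn (y :: real^'n) \<noteq> \<infinity>"
    by (rule nn_integral_PInf_AE) (use nn_integral_Bker_nn [where ?'n = 'n] in auto)
  then show ?thesis
    by eventually_elim (simp add: Bker_eq_enn2real top.not_eq_extremum)
qed

lemma nn_integral_Bker_power_finite:
  "(\<integral>\<^sup>+ y. ennreal (Bker (y :: real^'n::finite)) * ennreal ((norm y ^ 2) ^ k) \<partial>lborel) < \<infinity>"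
proof -
  define C where "C = fact k * 8 ^ k * 2 powr (real CARD('n) / 2)"
  have C: "C \<ge> 0" by (simp add: C_def)
  have [measurable]: "(\<lambda>y. heat_kernel s (y :: real^'n)) \<in> borel_measurable borel" for s
    unfolding heat_kernel_def by measurable
  have "(\<integral>\<^sup>+ y. ennreal (Bker (y :: real^'n)) * ennreal ((norm y ^ 2) ^ k) \<partial>lborel)
      = (\<integral>\<^sup>+ y. Bker_nn (y :: real^'n) * ennreal ((norm y ^ 2) ^ k) \<partial>lborel)"
    by (rule nn_integral_cong_AE) (use Bker_nn_finite in \<open>eventually_elim, simp\<close>)
  also have "\<dots> = (\<integral>\<^sup>+ s. (ennreal (exp (- s)) * indicator {0<..} s) *
       (\<integral>\<^sup>+ y. ennreal (heat_kernel s (y :: real^'n)) * ennreal ((norm y ^ 2) ^ k) \<partial>lborel) \<partial>lborel)"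
    by (rule nn_integral_Bker_nn_mult) measurable
  also have "\<dots> \<le> (\<integral>\<^sup>+ s. ennreal C * (ennreal (s ^ k * exp (- s)) * indicator {0..} s) \<partial>lborel)"
  proof (rule nn_integral_mono)
    fix s :: real
    show "(ennreal (exp (- s)) * indicator {0<..} s) *
       (\<integral>\<^sup>+ y. ennreal (heat_kernel s (y :: real^'n)) * ennreal ((norm y ^ 2) ^ k) \<partial>lborel)
       \<le> ennreal C * (ennreal (s ^ k * exp (- s)) * indicator {0..} s)"
    proof (cases "s > 0")
      case True
      have "(\<integral>\<^sup>+ y. ennreal (heat_kernel s (y :: real^'n)) * ennreal ((norm y ^ 2) ^ k) \<partial>lborel)
          \<le> (\<integral>\<^sup>+ y. ennreal (C * s ^ k) * ennreal (heat_kernel (2 * s) (y :: real^'n)) \<partial>lborel)"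
      proof (rule nn_integral_mono)
        fix y :: "real^'n"
        have "heat_kernel s y * (norm y ^ 2) ^ k \<le> C * s ^ k * heat_kernel (2 * s) y"
          using power_times_heat_kernel_le [OF True, of y k] by (simp add: C_def mult_ac)
        then show "ennreal (heat_kernel s y) * ennreal ((norm y ^ 2) ^ k)
            \<le> ennreal (C * s ^ k) * ennreal (heat_kernel (2 * s) y)"
          using True C by (simp add: ennreal_mult [symmetric] heat_kernel_nonneg)
      qed
      also have "\<dots> = ennreal (C * s ^ k)"
        using True by (subst nn_integral_cmult) (auto simp: nn_integral_heat_kernel)
      finally have "ennreal (exp (- s)) *
          (\<integral>\<^sup>+ y. ennreal (heat_kernel s (y :: real^'n)) * ennreal ((norm y ^ 2) ^ k) \<partial>lborel)
          \<le> ennreal (exp (- s)) * ennreal (C * s ^ k)"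
        by (rule mult_left_mono) simp
      also have "\<dots> = ennreal C * ennreal (s ^ k * exp (- s))"
        using True C by (simp add: ennreal_mult [symmetric] mult_ac)
      finally show ?thesis using True by simp
    qed simp
  qed
  also have "\<dots> = ennreal C * ennreal (real_of_nat (fact k))"
    by (subst nn_integral_cmult, simp, subst nn_intergal_power_times_exp_Ici, simp)
  also have "\<dots> < \<infinity>"
    by (simp add: ennreal_mult_less_top)
  finally show ?thesis .
qed

text \<open>With B as the law of a random displacement Y, convolution is the expectation of \<phi>(x
  - Y), and linearity, monotonicity and dominated convergence are those of a probability
  measure.\<close>

definition Bmeas :: "(real^'n::finite) measure" where
  "Bmeas = density lborel (\<lambda>y. ennreal (Bker y))"

lemma sets_Bmeas [measurable_cong, simp]: "sets Bmeas = sets borel"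
  by (simp add: Bmeas_def)

lemma space_Bmeas [simp]: "space Bmeas = UNIV"
  by (simp add: Bmeas_def)

lemma prob_space_Bmeas: "prob_space (Bmeas :: (real^'n::finite) measure)"
proof
  have "emeasure Bmeas (space (Bmeas :: (real^'n) measure)) = (\<integral>\<^sup>+ y. ennreal (Bker (y :: real^'n)) \<partial>lborel)"
    by (simp add: Bmeas_def emeasure_density)
  also have "\<dots> = (\<integral>\<^sup>+ y. Bker_nn (y :: real^'n) \<partial>lborel)"
    by (rule nn_integral_cong_AE) (use Bker_nn_finite in \<open>eventually_elim, simp\<close>)
  finally show "emeasure Bmeas (space (Bmeas :: (real^'n) measure)) = 1"
    by (simp add: nn_integral_Bker_nn)
qed

lemma integrable_Bmeas_norm_power: "integrable Bmeas (\<lambda>y :: real^'n::finite. (norm y ^ 2) ^ k)"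
proof (rule integrableI_nonneg)
  show "(\<integral>\<^sup>+ y. ennreal ((norm y ^ 2) ^ k) \<partial>(Bmeas :: (real^'n) measure)) < \<infinity>"
    unfolding Bmeas_def using nn_integral_Bker_power_finite [of k, where ?'n = 'n] by (subst nn_integral_density) auto
qed (simp_all add: Bmeas_def)

text \<open>\<open>Bop\<close> is a gauge integral, and integrability identifies it with the
  Lebesgue integral; the reflection about x then moves the shift from the kernel to \<phi>.\<close>

lemma Bop_eq_integral_Bmeas:
  assumes [measurable]: "\<phi> \<in> borel_measurable borel"
    and int: "integrable Bmeas (\<lambda>y. \<phi> (x - y))"
  shows "Bop \<phi> (x :: real^'n::finite) = (\<integral> y. \<phi> (x - y) \<partial>Bmeas)"
proof -
  define g where "g = (\<lambda>y. Bker y * \<phi> (x - y))"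
  have [measurable]: "g \<in> borel_measurable borel" unfolding g_def by measurable
  have refl: "lborel = distr lborel borel (\<lambda>y :: real^'n. x - y)"
    using lborel_affine [of "-1" x] by (simp add: density_1)
  have g: "integrable lborel g"
    using int unfolding g_def Bmeas_def by (subst (asm) integrable_density) (auto simp: Bker_nonneg)
  have "integrable lborel (\<lambda>y. g (x - y))"
    using g by (subst (asm) refl, subst (asm) integrable_distr_eq) auto
  then have "Bop \<phi> x = integral\<^sup>L lborel (\<lambda>y. g (x - y))"
    unfolding Bop_def by (subst integral_lborel [symmetric]) (auto simp: g_def)
  also have "\<dots> = integral\<^sup>L lborel g"
    by (subst (2) refl, subst integral_distr) auto
  also have "\<dots> = (\<integral> y. \<phi> (x - y) \<partial>Bmeas)"
    unfolding g_def Bmeas_def by (subst integral_density) (auto simp: Bker_nonneg)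
  finally show ?thesis .
qed

lemma Bker_minus: "Bker (- y) = Bker y"
  by (simp add: Bker_def)

text \<open>The kernel is even and the integrand odd, so the integral equals its own negative. This
  removes the first-order term of |x - y|^2.\<close>

lemma integral_Bmeas_inner: "(\<integral> y. x \<bullet> y \<partial>Bmeas) = (0 :: real)" for x :: "real^'n::finite"
proof -
  have refl: "lborel = distr lborel borel (\<lambda>y :: real^'n. - y)"
    using lborel_affine [of "-1" "0 :: real^'n"] by (simp add: density_1)
  have "(\<integral> y. x \<bullet> y \<partial>Bmeas) = (\<integral> y. Bker y * (x \<bullet> y) \<partial>lborel)"
    unfolding Bmeas_def by (subst integral_density) (auto simp: Bker_nonneg)
  also have "\<dots> = (\<integral> y. Bker (- y) * (x \<bullet> (- y)) \<partial>lborel)"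
    by (subst refl, subst integral_distr) auto
  also have "\<dots> = - (\<integral> y. Bker y * (x \<bullet> y) \<partial>lborel)"
    by (simp add: Bker_minus)
  also have "(\<integral> y. Bker y * (x \<bullet> y) \<partial>lborel) = (\<integral> y. x \<bullet> y \<partial>Bmeas)"
    unfolding Bmeas_def by (subst integral_density) (auto simp: Bker_nonneg)
  finally show ?thesis by simp
qed

text \<open>A vanishing second moment would concentrate the measure at the origin, impossible for a
  probability measure with a density. The strict sign makes the barrier of the lower bound grow in
  time.\<close>

lemma Bmeas_second_moment_pos: "(\<integral> y. norm y ^ 2 \<partial>(Bmeas :: (real^'n::finite) measure)) > 0"
proof (rule ccontr)
  interpret prob_space "Bmeas :: (real^'n) measure" by (rule prob_space_Bmeas)
  have int: "integrable Bmeas (\<lambda>y :: real^'n. norm y ^ 2)"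
    using integrable_Bmeas_norm_power [of 1] by simp
  assume "\<not> ?thesis"
  moreover have "(\<integral> y. norm y ^ 2 \<partial>(Bmeas :: (real^'n) measure)) \<ge> 0" by simp
  ultimately have "(\<integral> y. norm y ^ 2 \<partial>(Bmeas :: (real^'n) measure)) = 0" by linarith
  then have "AE y in (Bmeas :: (real^'n) measure). norm y ^ 2 = 0"
    using int by (subst (asm) integral_nonneg_eq_0_iff_AE) auto
  moreover have "AE y in (Bmeas :: (real^'n) measure). y \<noteq> 0"
    unfolding Bmeas_def
    by (subst AE_density) (use AE_lborel_singleton [of "0 :: real^'n"] in \<open>auto\<close>)
  ultimately have "AE y in (Bmeas :: (real^'n) measure). False"
    by eventually_elim simp
  then show False by simp
qed

section \<open>The operator on functions of polynomial growth\<close>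

text \<open>Weighted arithmetic-geometric mean inequality for z / z0 and 1, rescaled. It serves to
  pass from integer to real exponents, to bound a power p by a linear function, and to linearise the
  source.\<close>

lemma powr_le_tangent:
  fixes z z0 \<theta> :: real
  assumes "0 \<le> \<theta>" "\<theta> \<le> 1" "z \<ge> 0" "z0 > 0"
  shows "z powr \<theta> \<le> z0 powr \<theta> + \<theta> * z0 powr (\<theta> - 1) * (z - z0)"
proof -
  have "(z / z0) powr \<theta> * 1 powr (1 - \<theta>) \<le> \<theta> * (z / z0) + (1 - \<theta>) * 1"
  proof (cases "z = 0")
    case False
    then show ?thesis by (intro Youngs_inequality_0) (use assms in auto)
  qed (use assms in auto)
  then have "z0 powr \<theta> * (z / z0) powr \<theta> \<le> z0 powr \<theta> * (1 + \<theta> * (z - z0) / z0)"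
    using assms by (intro mult_left_mono) (auto simp: field_simps)
  moreover have "z0 powr \<theta> * (z / z0) powr \<theta> = z powr \<theta>"
    using assms by (simp add: powr_divide)
  moreover have "z0 powr (\<theta> - 1) = z0 powr \<theta> / z0"
    using assms by (simp add: powr_diff)
  moreover have "z0 powr \<theta> * (1 + \<theta> * (z - z0) / z0) = z0 powr \<theta> + \<theta> * (z0 powr \<theta> / z0) * (z - z0)"
    by (simp add: distrib_left)
  ultimately show ?thesis by simp
qed

text \<open>All moments of B are finite, so convolution converges on this class, and there
  \<open>Bop\<close> is linear and monotone. Weights, barriers and solutions belong to it, which
  keeps integrability out of the later arguments.\<close>

definition poly_growth :: "(real^'n::finite \<Rightarrow> real) \<Rightarrow> bool" where
  "poly_growth \<phi> \<longleftrightarrow> continuous_on UNIV \<phi> \<and> (\<exists>C (j :: nat). \<forall>y. \<bar>\<phi> y\<bar> \<le> C * (1 + norm y ^ 2) ^ j)"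

lemma poly_growthI:
  "continuous_on UNIV \<phi> \<Longrightarrow> (\<And>y. \<bar>\<phi> y\<bar> \<le> C * (1 + norm y ^ 2) ^ j) \<Longrightarrow> poly_growth \<phi>"
  unfolding poly_growth_def by blast

lemma integrable_Bmeas_weight: "integrable Bmeas (\<lambda>y :: real^'n::finite. (1 + norm y ^ 2) ^ j)"
proof -
  have "integrable Bmeas (\<lambda>y :: real^'n. \<Sum>k\<le>j. of_nat (j choose k) * (norm y ^ 2) ^ k)"
    by (intro Bochner_Integration.integrable_sum integrable_mult_right integrable_Bmeas_norm_power)
  then show ?thesis
    by (subst add.commute, subst binomial_ring) simp
qed

text \<open>Peetre's inequality; it separates x from the integration variable.\<close>

lemma shifted_weight_le: "1 + norm (x - y) ^ 2 \<le> 2 * (1 + norm x ^ 2) * (1 + norm y ^ 2)"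
  for x y :: "'a::real_inner"
proof -
  have "norm (x - y) ^ 2 \<le> (norm x + norm y) ^ 2"
    by (intro power_mono norm_triangle_ineq4) simp
  also have "\<dots> \<le> 2 * norm x ^ 2 + 2 * norm y ^ 2"
    using sum_squares_bound [of "norm x" "norm y"] by (simp add: power2_sum)
  finally have "norm (x - y) ^ 2 \<le> 2 * norm x ^ 2 + 2 * norm y ^ 2" .
  moreover have "0 \<le> norm x ^ 2 * norm y ^ 2" by simp
  moreover have "2 * (1 + norm x ^ 2) * (1 + norm y ^ 2)
      = 2 + 2 * norm x ^ 2 + 2 * norm y ^ 2 + 2 * (norm x ^ 2 * norm y ^ 2)"
    by (simp add: distrib_left distrib_right)
  ultimately show ?thesis by linarith
qed

lemma poly_growth_integrable:
  assumes "poly_growth \<phi>"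
  shows "integrable Bmeas (\<lambda>y. \<phi> (x - y :: real^'n::finite))"
proof -
  obtain C j where C: "\<And>y. \<bar>\<phi> y\<bar> \<le> C * (1 + norm y ^ 2) ^ j" and cont: "continuous_on UNIV \<phi>"
    using assms unfolding poly_growth_def by blast
  have [measurable]: "\<phi> \<in> borel_measurable borel"
    using cont by (rule borel_measurable_continuous_onI)
  have "\<bar>\<phi> (x - y)\<bar> \<le> \<bar>C\<bar> * (2 * (1 + norm x ^ 2)) ^ j * (1 + norm y ^ 2) ^ j" for y
  proof -
    have "\<bar>\<phi> (x - y)\<bar> \<le> \<bar>C\<bar> * (1 + norm (x - y) ^ 2) ^ j"
      using C [of "x - y"] by (rule order_trans) (intro mult_right_mono, auto)
    also have "\<dots> \<le> \<bar>C\<bar> * (2 * (1 + norm x ^ 2) * (1 + norm y ^ 2)) ^ j"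
      by (intro mult_left_mono power_mono shifted_weight_le) auto
    finally show ?thesis by (simp add: power_mult_distrib)
  qed
  then show ?thesis
    by (intro Bochner_Integration.integrable_bound
        [OF integrable_mult_right [OF integrable_Bmeas_weight [of j], of "\<bar>C\<bar> * (2 * (1 + norm x ^ 2)) ^ j"]])
       (auto simp: abs_mult intro!: AE_I2 order_trans [OF _ abs_ge_self])
qed

lemma poly_growth_Bop: "poly_growth \<phi> \<Longrightarrow> Bop \<phi> x = (\<integral> y. \<phi> (x - y) \<partial>Bmeas)"
  by (rule Bop_eq_integral_Bmeas)
     (auto simp: poly_growth_integrable poly_growth_def borel_measurable_continuous_onI)

lemma poly_growth_cmult:
  assumes "poly_growth \<phi>" shows "poly_growth (\<lambda>y. c * \<phi> y)"
proof -
  obtain C j where C: "\<And>y. \<bar>\<phi> y\<bar> \<le> C * (1 + norm y ^ 2) ^ j" and cont: "continuous_on UNIV \<phi>"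
    using assms unfolding poly_growth_def by blast
  show ?thesis
  proof (rule poly_growthI)
    show "\<bar>c * \<phi> y\<bar> \<le> (\<bar>c\<bar> * C) * (1 + norm y ^ 2) ^ j" for y
      using mult_left_mono [OF C, of "\<bar>c\<bar>" y] by (simp add: abs_mult mult_ac)
  qed (intro continuous_intros cont)
qed

lemma poly_growth_add:
  assumes "poly_growth \<phi>" "poly_growth \<psi>" shows "poly_growth (\<lambda>y. \<phi> y + \<psi> y)"
proof -
  obtain C j where C: "\<And>y. \<bar>\<phi> y\<bar> \<le> C * (1 + norm y ^ 2) ^ j" and c1: "continuous_on UNIV \<phi>"
    using assms(1) unfolding poly_growth_def by blast
  obtain D k where D: "\<And>y. \<bar>\<psi> y\<bar> \<le> D * (1 + norm y ^ 2) ^ k" and c2: "continuous_on UNIV \<psi>"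
    using assms(2) unfolding poly_growth_def by blast
  show ?thesis
  proof (rule poly_growthI)
    fix y :: "real^'a"
    have "\<bar>\<phi> y\<bar> \<le> \<bar>C\<bar> * (1 + norm y ^ 2) ^ (j + k)"
      by (rule order_trans [OF C]) (intro mult_mono power_increasing, auto)
    moreover have "\<bar>\<psi> y\<bar> \<le> \<bar>D\<bar> * (1 + norm y ^ 2) ^ (j + k)"
      by (rule order_trans [OF D]) (intro mult_mono power_increasing, auto)
    ultimately show "\<bar>\<phi> y + \<psi> y\<bar> \<le> (\<bar>C\<bar> + \<bar>D\<bar>) * (1 + norm y ^ 2) ^ (j + k)"
      by (simp add: distrib_right)
  qed (intro continuous_intros c1 c2)
qed

lemma poly_growth_diff:
  assumes "poly_growth \<phi>" "poly_growth \<psi>" shows "poly_growth (\<lambda>y. \<phi> y - \<psi> y)"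
  using poly_growth_add [OF assms(1) poly_growth_cmult [OF assms(2), of "-1"]] by simp

lemma poly_growth_weight:
  fixes s b :: real
  assumes "s > 0" "b \<ge> 0"
  shows "poly_growth (\<lambda>y :: real^'n::finite. (s + norm y ^ 2) powr b)"
proof (rule poly_growthI)
  fix y :: "real^'n"
  \<comment> \<open>The factor \<open>max s 1\<close> brings the base up to at least 1, so that the
    exponent may be rounded up to an integer.\<close>
  have "(s + norm y ^ 2) powr b \<le> (max s 1 * (1 + norm y ^ 2)) powr b"
  proof (rule powr_mono2)
    have "1 * norm y ^ 2 \<le> max s 1 * norm y ^ 2" by (intro mult_right_mono) auto
    then show "s + norm y ^ 2 \<le> max s 1 * (1 + norm y ^ 2)" by (simp add: distrib_left)
  qed (use assms in auto)
  also have "\<dots> \<le> (max s 1 * (1 + norm y ^ 2)) powr (real (nat \<lceil>b\<rceil>))"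
  proof (rule powr_mono)
    have "1 * 1 \<le> max s 1 * (1 + norm y ^ 2)" by (intro mult_mono) auto
    then show "1 \<le> max s 1 * (1 + norm y ^ 2)" by simp
  qed linarith
  also have "\<dots> = (max s 1 * (1 + norm y ^ 2)) ^ nat \<lceil>b\<rceil>"
    by (intro powr_realpow mult_pos_pos) (auto simp: add_pos_nonneg)
  finally show "\<bar>(s + norm y ^ 2) powr b\<bar> \<le> max s 1 ^ nat \<lceil>b\<rceil> * (1 + norm y ^ 2) ^ nat \<lceil>b\<rceil>"
    by (simp add: power_mult_distrib)
next
  have "s + norm y ^ 2 \<noteq> 0" for y :: "real^'n"
    using assms by (smt (verit) zero_le_power2)
  then show "continuous_on UNIV (\<lambda>y :: real^'n. (s + norm y ^ 2) powr b)"
    by (intro continuous_intros) auto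
qed

lemma poly_growth_weight_power:
  assumes "s > 0"
  shows "poly_growth (\<lambda>y :: real^'n::finite. (s + norm y ^ 2) ^ m)"
proof -
  have "(s + norm y ^ 2) powr (real m) = (s + norm y ^ 2) ^ m" for y :: "real^'n"
    using assms by (intro powr_realpow) (simp add: add_pos_nonneg)
  then show ?thesis using poly_growth_weight [OF assms, of "real m", where ?'n = 'n] by simp
qed

lemma Bop_cmult: "poly_growth \<phi> \<Longrightarrow> Bop (\<lambda>y. c * \<phi> y) x = c * Bop \<phi> x"
  by (simp add: poly_growth_Bop poly_growth_cmult)

lemma Bop_add: "poly_growth \<phi> \<Longrightarrow> poly_growth \<psi> \<Longrightarrow> Bop (\<lambda>y. \<phi> y + \<psi> y) x = Bop \<phi> x + Bop \<psi> x"
  by (simp add: poly_growth_Bop poly_growth_add poly_growth_integrable)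

lemma Bop_diff: "poly_growth \<phi> \<Longrightarrow> poly_growth \<psi> \<Longrightarrow> Bop (\<lambda>y. \<phi> y - \<psi> y) x = Bop \<phi> x - Bop \<psi> x"
  by (simp add: poly_growth_Bop poly_growth_diff poly_growth_integrable)

lemma Bop_mono:
  "poly_growth \<phi> \<Longrightarrow> poly_growth \<psi> \<Longrightarrow> (\<And>y. \<phi> y \<le> \<psi> y) \<Longrightarrow> Bop \<phi> x \<le> Bop \<psi> x"
  by (simp add: poly_growth_Bop) (intro integral_mono poly_growth_integrable)

lemma poly_growth_const: "poly_growth (\<lambda>_. c)"
  by (rule poly_growthI [where C = "\<bar>c\<bar>" and j = 0]) auto

lemma Bop_const: "Bop (\<lambda>_. c) (x :: real^'n::finite) = c"
proof -
  interpret prob_space "Bmeas :: (real^'n) measure" by (rule prob_space_Bmeas)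
  show ?thesis using prob_space by (simp add: poly_growth_Bop poly_growth_const)
qed

text \<open>A divergent gauge integral has value 0, so positivity holds for every nonnegative
  function; the lower bound can thus discard the source whatever its growth.\<close>

lemma Bop_nonneg: "(\<And>y. \<phi> y \<ge> 0) \<Longrightarrow> Bop \<phi> x \<ge> 0"
  unfolding Bop_def
  by (cases "(\<lambda>y. Bker (x - y) * \<phi> y) integrable_on UNIV")
     (auto intro!: integral_nonneg simp: Bker_nonneg not_integrable_integral)

text \<open>Dominated convergence along sequences, with a majorant independent of time. It supplies
  the integrability in time of the terms of the integral equation.\<close>

lemma continuous_on_Bop_time:
  fixes f :: "real \<Rightarrow> real^'n::finite \<Rightarrow> real"
  assumes cont_x: "\<And>\<tau>. \<tau> \<in> S \<Longrightarrow> continuous_on UNIV (f \<tau>)"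
    and cont_t: "\<And>y. continuous_on S (\<lambda>\<tau>. f \<tau> y)"
    and bound: "\<And>\<tau> y. \<tau> \<in> S \<Longrightarrow> \<bar>f \<tau> y\<bar> \<le> h y" and h: "poly_growth h"
  shows "continuous_on S (\<lambda>\<tau>. Bop (f \<tau>) x)"
  unfolding continuous_on_sequentially
proof (intro allI ballI impI)
  fix s :: "nat \<Rightarrow> real" and \<tau>
  assume \<tau>: "\<tau> \<in> S" and s: "(\<forall>n. s n \<in> S) \<and> s \<longlonglongrightarrow> \<tau>"
  obtain C j where C: "\<And>y. \<bar>h y\<bar> \<le> C * (1 + norm y ^ 2) ^ j"
    using h unfolding poly_growth_def by blast
  have pg: "poly_growth (f \<tau>)" if "\<tau> \<in> S" for \<tau>
    by (rule poly_growthI [OF cont_x [OF that]])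
       (rule order_trans [OF bound [OF that] order_trans [OF abs_ge_self C]])
  have "(\<lambda>n. \<integral> y. f (s n) (x - y) \<partial>Bmeas) \<longlonglongrightarrow> (\<integral> y. f \<tau> (x - y) \<partial>Bmeas)"
  proof (rule integral_dominated_convergence [where w = "\<lambda>y. h (x - y)"])
    show "integrable Bmeas (\<lambda>y. h (x - y))" by (rule poly_growth_integrable [OF h])
    show "AE y in Bmeas. (\<lambda>n. f (s n) (x - y)) \<longlonglongrightarrow> f \<tau> (x - y)"
      using cont_t s \<tau> unfolding continuous_on_sequentially by (auto simp: o_def)
    show "AE y in Bmeas. norm (f (s n) (x - y)) \<le> h (x - y)" for n
      using bound s by auto
  qed (use \<tau> s in \<open>auto intro!: borel_measurable_integrable poly_growth_integrable pg\<close>)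
  then show "((\<lambda>\<tau>. Bop (f \<tau>) x) \<circ> s) \<longlonglongrightarrow> Bop (f \<tau>) x"
    using pg \<tau> s by (simp add: poly_growth_Bop o_def)
qed

section \<open>Convolution of powers of s + |x|^2\<close>

text \<open>An increment of order sqrt Q has a square of order Q, so the second-order remainder
  loses a full power of Q. The linear term is kept exact because only its mean is small, not its
  size. \<open>Q + h \<ge> 0\<close> lets the induction multiply by Q + h.\<close>

lemma power_add_le_taylor:
  fixes Q h r :: real
  assumes Q: "Q \<ge> 1" and r: "r \<ge> 0" and h: "\<bar>h\<bar> \<le> sqrt Q * r" and Qh: "Q + h \<ge> 0"
  shows "(Q + h) ^ Suc m \<le> Q ^ Suc m + real (Suc m) * Q ^ m * h + Q ^ m * (real (Suc m) ^ 2 * (1 + r) ^ Suc m)"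
proof (induction m)
  case 0
  then show ?case using r by simp
next
  case (Suc m)
  define D where "D = real (Suc m) ^ 2 * (1 + r) ^ Suc m"
  have D0: "D \<ge> 0" using r by (simp add: D_def)
  have h2: "h\<^sup>2 \<le> Q * r\<^sup>2"
    using power_mono [OF h, of 2] Q by (simp add: power_mult_distrib)
  have "sqrt Q \<le> Q" using Q by (simp add: real_le_lsqrt self_le_power)
  then have "sqrt Q * r \<le> Q * r" using r by (rule mult_right_mono)
  with h have Qh1: "Q + h \<le> Q * (1 + r)" by (simp add: distrib_left)
  have "(Q + h) ^ Suc (Suc m) \<le> (Q + h) * (Q ^ Suc m + real (Suc m) * Q ^ m * h + Q ^ m * D)"
    using mult_left_mono [OF Suc Qh] by (simp add: D_def)
  also have "\<dots> = Q ^ Suc (Suc m) + real (Suc (Suc m)) * Q ^ Suc m * h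
      + real (Suc m) * Q ^ m * h\<^sup>2 + (Q + h) * (Q ^ m * D)"
    by (simp add: algebra_simps power2_eq_square)
  also have "\<dots> \<le> Q ^ Suc (Suc m) + real (Suc (Suc m)) * Q ^ Suc m * h
      + real (Suc m) * Q ^ m * (Q * r\<^sup>2) + (Q * (1 + r)) * (Q ^ m * D)"
    using Q D0 by (intro add_mono order_refl mult_left_mono mult_right_mono h2 Qh1) auto
  also have "\<dots> = Q ^ Suc (Suc m) + real (Suc (Suc m)) * Q ^ Suc m * h
      + Q ^ Suc m * (real (Suc m) * r\<^sup>2 + (1 + r) * D)"
    by (simp add: algebra_simps)
  also have "\<dots> \<le> Q ^ Suc (Suc m) + real (Suc (Suc m)) * Q ^ Suc m * h
      + Q ^ Suc m * (real (Suc (Suc m)) ^ 2 * (1 + r) ^ Suc (Suc m))"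
  proof -
    have "r\<^sup>2 \<le> (1 + r) ^ 2" using r by (intro power_mono) auto
    also have "\<dots> \<le> (1 + r) ^ Suc (Suc m)" using r by (intro power_increasing) auto
    finally have "real (Suc m) * r\<^sup>2 \<le> real (2 * m + 3) * (1 + r) ^ Suc (Suc m)"
      by (intro mult_mono) auto
    \<comment> \<open>The square in the constant is chosen so that its increment 2 m + 3 covers the
      coefficient m + 1 of \<open>r\<^sup>2\<close>.\<close>
    moreover have "real (Suc (Suc m)) ^ 2 = real (Suc m) ^ 2 + real (2 * m + 3)"
      by (simp add: power2_eq_square algebra_simps)
    moreover have "(1 + r) * D = real (Suc m) ^ 2 * (1 + r) ^ Suc (Suc m)"
      by (simp add: D_def)
    ultimately have "real (Suc m) * r\<^sup>2 + (1 + r) * D \<le> real (Suc (Suc m)) ^ 2 * (1 + r) ^ Suc (Suc m)"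
      by (simp only: distrib_right)
    then show ?thesis using Q by (intro add_left_mono mult_left_mono) auto
  qed
  finally show ?case .
qed

text \<open>In the expansion of |x - y|^2 the cross term has mean zero. Being an equality, this
  serves from below as well as from above.\<close>

lemma Bop_square_norm:
  "Bop (\<lambda>y. norm y ^ 2) (x :: real^'n::finite) = norm x ^ 2 + (\<integral> y. norm y ^ 2 \<partial>(Bmeas :: (real^'n) measure))"
proof -
  interpret prob_space "Bmeas :: (real^'n) measure" by (rule prob_space_Bmeas)
  have i2: "integrable Bmeas (\<lambda>y :: real^'n. norm y ^ 2)"
    using integrable_Bmeas_norm_power [of 1] by simp
  have "poly_growth (\<lambda>y :: real^'n. (x \<bullet> y))"
  proof (rule poly_growthI)
    fix y :: "real^'n"
    have "\<bar>x \<bullet> y\<bar> \<le> norm x * norm y" by (rule Cauchy_Schwarz_ineq2)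
    also have "norm y \<le> 1 + norm y ^ 2" using sum_squares_bound [of "1 / 2" "norm y"] by (simp add: power_divide)
    finally show "\<bar>x \<bullet> y\<bar> \<le> norm x * (1 + norm y ^ 2) ^ 1" by (simp add: mult_left_mono)
  qed (intro continuous_intros)
  from poly_growth_integrable [OF this, of 0] have i1: "integrable Bmeas (\<lambda>y. x \<bullet> y)" by simp
  have pg: "poly_growth (\<lambda>y :: real^'n. norm y ^ 2)"
    by (rule poly_growthI [where C = 1 and j = 1]) (auto intro!: continuous_intros)
  have "Bop (\<lambda>y. norm y ^ 2) x = (\<integral> y. norm x ^ 2 + (norm y ^ 2 - 2 * (x \<bullet> y)) \<partial>Bmeas)"
    unfolding poly_growth_Bop [OF pg]
    by (intro Bochner_Integration.integral_cong) (auto simp: power2_norm_eq_inner inner_diff inner_commute algebra_simps)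
  also have "\<dots> = norm x ^ 2 + (\<integral> y. norm y ^ 2 \<partial>(Bmeas :: (real^'n) measure))"
    using i1 i2 prob_space by (simp add: integral_Bmeas_inner)
  finally show ?thesis .
qed

text \<open>Average the Taylor bound with h = |x - y|^2 - |x|^2, which can be of order sqrt Q but
  has constant mean. K must be uniform in s because s will be 1 + k t.\<close>

lemma Bop_weight_power_le:
  "\<exists>K\<ge>0. \<forall>s\<ge>1. \<forall>x :: real^'n::finite.
     Bop (\<lambda>y. (s + norm y ^ 2) ^ Suc m) x \<le> (s + norm x ^ 2) ^ Suc m + K * (s + norm x ^ 2) ^ m"
proof -
  interpret prob_space "Bmeas :: (real^'n) measure" by (rule prob_space_Bmeas)
  define c where "c = real (Suc m) ^ 2 * 2 ^ Suc m"
  define m2 where "m2 = (\<integral> y. norm y ^ 2 \<partial>(Bmeas :: (real^'n) measure))"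
  define I where "I = (\<integral> y. (1 + norm y ^ 2) ^ Suc m \<partial>(Bmeas :: (real^'n) measure))"
  have i2: "integrable Bmeas (\<lambda>y :: real^'n. norm y ^ 2)"
    using integrable_Bmeas_norm_power [of 1] by simp
  have i3: "integrable Bmeas (\<lambda>y :: real^'n. (1 + norm y ^ 2) ^ Suc m)"
    by (rule integrable_Bmeas_weight)
  have "Bop (\<lambda>y. (s + norm y ^ 2) ^ Suc m) x \<le> (s + norm x ^ 2) ^ Suc m + (real (Suc m) * m2 + c * I) * (s + norm x ^ 2) ^ m"
    if s: "s \<ge> 1" for s and x :: "real^'n"
  proof -
    define Q where "Q = s + norm x ^ 2"
    have Q: "Q \<ge> 1" using s by (simp add: Q_def add_increasing2)
    have pg: "poly_growth (\<lambda>y :: real^'n. norm y ^ 2)"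
      by (rule poly_growthI [where C = 1 and j = 1]) (auto intro!: continuous_intros)
    define h where "h = (\<lambda>y. norm (x - y) ^ 2 - norm x ^ 2)"
    have ih: "integrable Bmeas h"
      unfolding h_def using poly_growth_integrable [OF pg, of x] by simp
    have Eh: "(\<integral> y. h y \<partial>Bmeas) = m2"
      using Bop_square_norm [of x] prob_space poly_growth_integrable [OF pg, of x]
      unfolding h_def by (simp add: m2_def poly_growth_Bop [OF pg])
    have pt: "(s + norm (x - y) ^ 2) ^ Suc m
        \<le> Q ^ Suc m + real (Suc m) * Q ^ m * h y + Q ^ m * c * (1 + norm y ^ 2) ^ Suc m" for y
    proof -
      \<comment> \<open>|h| is at most 2 |x| |y| + |y|^2, and both |x| and 1 are at most sqrt
        Q.\<close>
      define r where "r = 2 * norm y + norm y ^ 2"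
      have r: "r \<ge> 0" by (simp add: r_def)
      have hy: "h y = norm y ^ 2 - 2 * (x \<bullet> y)"
        by (simp add: h_def power2_norm_eq_inner inner_diff inner_commute)
      have nx: "norm x \<le> sqrt Q"
        using s by (intro real_le_rsqrt) (simp add: Q_def)
      have "\<bar>h y\<bar> \<le> norm y ^ 2 + 2 * (norm x * norm y)"
        unfolding hy using Cauchy_Schwarz_ineq2 [of x y] by (smt (verit) zero_le_power2)
      also have "\<dots> \<le> sqrt Q * norm y ^ 2 + 2 * (sqrt Q * norm y)"
        using nx Q by (intro add_mono mult_left_mono mult_right_mono) (auto simp: mult_le_cancel_right1)
      also have "\<dots> = sqrt Q * r" by (simp add: r_def algebra_simps)
      finally have hr: "\<bar>h y\<bar> \<le> sqrt Q * r" .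
      have Qh: "Q + h y = s + norm (x - y) ^ 2" by (simp add: Q_def h_def)
      have "1 + r \<le> 2 * (1 + norm y ^ 2)"
        using sum_squares_bound [of 1 "norm y"] by (simp add: r_def)
      then have "(1 + r) ^ Suc m \<le> (2 * (1 + norm y ^ 2)) ^ Suc m"
        using r by (intro power_mono) auto
      then have "real (Suc m) ^ 2 * (1 + r) ^ Suc m \<le> real (Suc m) ^ 2 * (2 * (1 + norm y ^ 2)) ^ Suc m"
        by (rule mult_left_mono) simp
      also have "\<dots> = c * (1 + norm y ^ 2) ^ Suc m"
        unfolding c_def power_mult_distrib by simp
      finally have "Q ^ m * (real (Suc m) ^ 2 * (1 + r) ^ Suc m) \<le> Q ^ m * (c * (1 + norm y ^ 2) ^ Suc m)"
        using Q by (intro mult_left_mono) auto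
      moreover have "(Q + h y) ^ Suc m \<le> Q ^ Suc m + real (Suc m) * Q ^ m * h y + Q ^ m * (real (Suc m) ^ 2 * (1 + r) ^ Suc m)"
        by (rule power_add_le_taylor [OF Q r hr]) (use s in \<open>simp add: Qh\<close>)
      ultimately show ?thesis by (simp only: Qh mult.assoc)
    qed
    have s0: "s > 0" using s by simp
    have "Bop (\<lambda>y. (s + norm y ^ 2) ^ Suc m) x = (\<integral> y. (s + norm (x - y) ^ 2) ^ Suc m \<partial>Bmeas)"
      by (rule poly_growth_Bop [OF poly_growth_weight_power [OF s0]])
    also have "\<dots> \<le> (\<integral> y. Q ^ Suc m + real (Suc m) * Q ^ m * h y + Q ^ m * c * (1 + norm y ^ 2) ^ Suc m \<partial>Bmeas)"
    proof (rule integral_mono [OF _ _ pt])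
      show "integrable Bmeas (\<lambda>y. (s + norm (x - y) ^ 2) ^ Suc m)"
        by (rule poly_growth_integrable [OF poly_growth_weight_power [OF s0]])
      show "integrable Bmeas (\<lambda>y. Q ^ Suc m + real (Suc m) * Q ^ m * h y + Q ^ m * c * (1 + norm y ^ 2) ^ Suc m)"
        by (intro Bochner_Integration.integrable_add integrable_mult_right ih i3) simp
    qed
    also have "\<dots> = (\<integral> y. Q ^ Suc m + real (Suc m) * Q ^ m * h y \<partial>Bmeas) + (\<integral> y. Q ^ m * c * (1 + norm y ^ 2) ^ Suc m \<partial>(Bmeas :: (real^'n) measure))"
      by (intro Bochner_Integration.integral_add Bochner_Integration.integrable_add integrable_mult_right ih i3) simp
    also have "(\<integral> y. Q ^ m * c * (1 + norm y ^ 2) ^ Suc m \<partial>(Bmeas :: (real^'n) measure)) = Q ^ m * c * I"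
      unfolding I_def using i3 by (intro Bochner_Integration.integral_mult_right)
    also have "(\<integral> y. Q ^ Suc m + real (Suc m) * Q ^ m * h y \<partial>Bmeas) = Q ^ Suc m + real (Suc m) * Q ^ m * m2"
      using prob_space by (subst Bochner_Integration.integral_add) (auto simp: ih Eh)
    finally show ?thesis by (simp add: Q_def algebra_simps)
  qed
  moreover have "real (Suc m) * m2 + c * I \<ge> 0"
    unfolding m2_def c_def I_def by (intro add_nonneg_nonneg mult_nonneg_nonneg integral_nonneg_AE) auto
  ultimately show ?thesis by blast
qed

text \<open>\<open>Q powr b\<close> is a concave power of \<open>Q ^ Suc m\<close>, hence lies below
  its tangent, and the integer case applies to that. The error has the form
  \<open>b * k * Q powr (b - 1)\<close> because this is the time derivative of (1 + k t + |x|^2)^b;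
  \<open>k \<ge> 1\<close> makes the latter base at least 1 + t.\<close>

lemma Bop_weight_le:
  fixes b :: real
  assumes b: "b \<ge> 0"
  shows "\<exists>k\<ge>1. \<forall>s\<ge>1. \<forall>x :: real^'n::finite.
     Bop (\<lambda>y. (s + norm y ^ 2) powr b) x \<le> (s + norm x ^ 2) powr b + b * k * (s + norm x ^ 2) powr (b - 1)"
proof -
  obtain m :: nat where "b \<le> real m"
    using real_arch_simple by blast
  then have m: "b \<le> real (Suc m)" by simp
  obtain K where K: "K \<ge> 0" "\<And>s x :: real^'n. s \<ge> 1 \<Longrightarrow>
     Bop (\<lambda>y. (s + norm y ^ 2) ^ Suc m) x \<le> (s + norm x ^ 2) ^ Suc m + K * (s + norm x ^ 2) ^ m"
    using Bop_weight_power_le [of m] by blast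
  define \<theta> where "\<theta> = b / real (Suc m)"
  have \<theta>: "0 \<le> \<theta>" "\<theta> \<le> 1" "real (Suc m) * \<theta> = b" using b m by (auto simp: \<theta>_def)
  have "Bop (\<lambda>y. (s + norm y ^ 2) powr b) x \<le> (s + norm x ^ 2) powr b + b * (K + 1) * (s + norm x ^ 2) powr (b - 1)"
    if s: "s \<ge> 1" for s and x :: "real^'n"
  proof -
    define Q where "Q = (\<lambda>y :: real^'n. s + norm y ^ 2)"
    have Q: "Q y \<ge> 1" for y using s by (simp add: Q_def add_increasing2)
    have Q0: "Q y > 0" for y using Q [of y] by linarith
    have Qb: "(Q y ^ Suc m) powr t = Q y powr (real (Suc m) * t)" for t y
      using Q0 [of y] by (subst powr_realpow [symmetric]) (simp_all only: powr_powr)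
    define A where "A = \<theta> * (Q x ^ Suc m) powr (\<theta> - 1)"
    have A: "A \<ge> 0" using \<theta> by (simp add: A_def)
    have pgm: "poly_growth (\<lambda>y. Q y ^ Suc m)" and pgb: "poly_growth (\<lambda>y. Q y powr b)"
      unfolding Q_def by (rule poly_growth_weight_power poly_growth_weight, use s b in simp_all)+
    have "Bop (\<lambda>y. Q y powr b) x \<le> Bop (\<lambda>y. (Q x powr b - A * Q x ^ Suc m) + A * Q y ^ Suc m) x"
    proof (rule Bop_mono)
      show "Q y powr b \<le> (Q x powr b - A * Q x ^ Suc m) + A * Q y ^ Suc m" for y
      proof -
        have "(Q y ^ Suc m) powr \<theta> \<le> (Q x ^ Suc m) powr \<theta> + A * (Q y ^ Suc m - Q x ^ Suc m)"
          unfolding A_def using Q0 [of x] Q0 [of y] by (intro powr_le_tangent \<theta>) auto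
        then show ?thesis
          unfolding Qb \<theta>(3) right_diff_distrib by linarith
      qed
    qed (intro poly_growth_add poly_growth_cmult poly_growth_const pgm pgb)+
    also have "\<dots> = (Q x powr b - A * Q x ^ Suc m) + A * Bop (\<lambda>y. Q y ^ Suc m) x"
      by (subst Bop_add) (auto simp: poly_growth_cmult poly_growth_const pgm Bop_const Bop_cmult simp del: power_Suc)
    also have "\<dots> \<le> (Q x powr b - A * Q x ^ Suc m) + A * (Q x ^ Suc m + K * Q x ^ m)"
      using K(2) [OF s, of x] A unfolding Q_def by (intro add_left_mono mult_left_mono) auto
    also have "\<dots> = Q x powr b + K * (A * Q x ^ m)"
      by (simp add: algebra_simps)
    also have "A * Q x ^ m = \<theta> * Q x powr (b - 1)"
    proof -
      have "Q x powr (real (Suc m) * (\<theta> - 1)) * Q x ^ m = Q x powr (real (Suc m) * (\<theta> - 1) + real m)"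
        using Q0 [of x] by (simp add: powr_add powr_realpow)
      also have "real (Suc m) * (\<theta> - 1) + real m = b - 1"
        using \<theta>(3) by (simp add: algebra_simps)
      finally show ?thesis by (simp only: A_def Qb mult.assoc)
    qed
    also have "Q x powr b + K * (\<theta> * Q x powr (b - 1)) \<le> Q x powr b + b * (K + 1) * Q x powr (b - 1)"
    proof -
      have "\<theta> \<le> b" using b by (simp add: \<theta>_def field_simps)
      then have "K * \<theta> \<le> K * b" using K(1) by (rule mult_left_mono)
      also have "\<dots> \<le> b * (K + 1)" using b by (simp add: algebra_simps)
      finally have "K * \<theta> * Q x powr (b - 1) \<le> b * (K + 1) * Q x powr (b - 1)"
        by (rule mult_right_mono) simp
      then show ?thesis by (simp add: mult.assoc)
    qed
    finally show ?thesis by (simp add: Q_def)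
  qed
  then show ?thesis using K(1) by (intro exI [of _ "K + 1"]) auto
qed

section \<open>A one-sided Gronwall argument\<close>

text \<open>Feeding a lower bound back into the inequality gains a factor C t / (j + 1) at pass j,
  and the factorial drives the defect to zero. The weight w controls growth in the unbounded space;
  g stays abstract since in the nonlinear comparison it is only bounded below in terms of d.\<close>

lemma integral_inequality_nonneg:
  fixes d g :: "real \<Rightarrow> 'a \<Rightarrow> real" and w :: "'a \<Rightarrow> real"
  assumes M: "\<And>t x. t \<in> {0..T} \<Longrightarrow> d t x \<ge> - (M * w x)"
    and MC: "M \<ge> 0" "C \<ge> 0"
    and step: "\<And>K \<tau> x. K \<ge> 0 \<Longrightarrow> \<tau> \<in> {0..T} \<Longrightarrow> (\<And>y. d \<tau> y \<ge> - (K * w y)) \<Longrightarrow> g \<tau> x \<ge> - (C * K * w x)"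
    and int: "\<And>x. (\<lambda>\<tau>. g \<tau> x) integrable_on {0..T}"
    and ineq: "\<And>t x. t \<in> {0..T} \<Longrightarrow> d t x \<ge> integral {0..t} (\<lambda>\<tau>. g \<tau> x)"
    and t: "t \<in> {0..T}"
  shows "d t x \<ge> 0"
proof -
  have iter: "\<forall>t\<in>{0..T}. \<forall>x. d t x \<ge> - (M * ((C * t) ^ j / fact j) * w x)" for j
  proof (induction j)
    case 0
    then show ?case using M by simp
  next
    case (Suc j)
    show ?case
    proof (intro ballI allI)
      fix t x assume t: "t \<in> {0..T}"
      define F where "F = (\<lambda>\<tau>. - (M * ((C * \<tau>) ^ Suc j / fact (Suc j)) * w x))"
      define f where "f = (\<lambda>\<tau>. - (C * (M * ((C * \<tau>) ^ j / fact j)) * w x))"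
      have "(f has_integral F t - F 0) {0..t}"
      proof (rule fundamental_theorem_of_calculus)
        fix \<tau> assume "\<tau> \<in> {0..t}"
        have "(F has_real_derivative - (M * (real (Suc j) * (C * \<tau>) ^ j * C / fact (Suc j)) * w x)) (at \<tau> within {0..t})"
          unfolding F_def by (auto intro!: derivative_eq_intros simp del: power_Suc fact_Suc)
        also have "- (M * (real (Suc j) * (C * \<tau>) ^ j * C / fact (Suc j)) * w x) = f \<tau>"
          by (simp add: f_def)
        finally show "(F has_vector_derivative f \<tau>) (at \<tau> within {0..t})"
          by (simp add: has_real_derivative_iff_has_vector_derivative)
      qed (use t in auto)
      moreover have "((\<lambda>\<tau>. g \<tau> x) has_integral integral {0..t} (\<lambda>\<tau>. g \<tau> x)) {0..t}"
        using integrable_on_subinterval [OF int] t by (intro integrable_integral) auto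
      moreover have "f \<tau> \<le> g \<tau> x" if "\<tau> \<in> {0..t}" for \<tau>
        unfolding f_def using that t MC Suc by (intro step) auto
      ultimately have "F t - F 0 \<le> integral {0..t} (\<lambda>\<tau>. g \<tau> x)"
        by (rule has_integral_le)
      then show "d t x \<ge> - (M * ((C * t) ^ Suc j / fact (Suc j)) * w x)"
        using ineq [OF t, of x] by (simp add: F_def)
    qed
  qed
  have "(\<lambda>j. (C * t) ^ j / fact j) \<longlonglongrightarrow> 0"
    using summable_LIMSEQ_zero [OF summable_exp [of "C * t"]] by (simp add: divide_inverse mult.commute)
  then have "(\<lambda>j. - (M * ((C * t) ^ j / fact j) * w x)) \<longlonglongrightarrow> - (M * 0 * w x)"
    by (intro tendsto_intros)
  then have "- (M * 0 * w x) \<le> d t x"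
    by (rule LIMSEQ_le_const2) (use iter t in auto)
  then show ?thesis by simp
qed

section \<open>Comparison principles\<close>

lemma poly_growth_bound:
  assumes "continuous_on UNIV \<phi>" "\<And>y. \<bar>\<phi> y\<bar> \<le> h y" "poly_growth h"
  shows "poly_growth \<phi>"
proof -
  obtain C j where C: "\<And>y. \<bar>h y\<bar> \<le> C * (1 + norm y ^ 2) ^ j"
    using assms(3) unfolding poly_growth_def by blast
  show ?thesis
    by (rule poly_growthI [OF assms(1)]) (rule order_trans [OF assms(2) order_trans [OF abs_ge_self C]])
qed

text \<open>Cruder than \<open>Bop_weight_le\<close>: this supplies the constant C of the
  iteration.\<close>

lemma Bop_unit_weight_le:
  fixes b :: real
  assumes b: "b \<ge> 0"
  shows "\<exists>C\<ge>0. \<forall>x :: real^'n::finite. Bop (\<lambda>y. (1 + norm y ^ 2) powr b) x \<le> C * (1 + norm x ^ 2) powr b"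
proof -
  obtain k where k: "k \<ge> 1" "\<And>s x :: real^'n. s \<ge> 1 \<Longrightarrow>
     Bop (\<lambda>y. (s + norm y ^ 2) powr b) x \<le> (s + norm x ^ 2) powr b + b * k * (s + norm x ^ 2) powr (b - 1)"
    using Bop_weight_le [OF b, where ?'n = 'n] by blast
  have "Bop (\<lambda>y. (1 + norm y ^ 2) powr b) x \<le> (1 + b * k) * (1 + norm x ^ 2) powr b" for x :: "real^'n"
  proof -
    have "b * k * (1 + norm x ^ 2) powr (b - 1) \<le> b * k * (1 + norm x ^ 2) powr b"
      using b k(1) by (intro mult_left_mono powr_mono) auto
    then show ?thesis using k(2) [of 1 x] by (simp add: distrib_right)
  qed
  then show ?thesis using b k(1) by (intro exI [of _ "1 + b * k"]) auto
qed

lemma Bop_ge_of_ge: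
  assumes "poly_growth \<phi>" "poly_growth w" "\<And>y. \<phi> y \<ge> - (K * w y)" "K \<ge> 0" "Bop w x \<le> C * w x"
  shows "Bop \<phi> x \<ge> - (C * K * w x)"
proof -
  have "Bop (\<lambda>y. - K * w y) x \<le> Bop \<phi> x"
    using assms by (intro Bop_mono poly_growth_cmult) auto
  moreover have "K * Bop w x \<le> K * (C * w x)"
    using assms by (intro mult_left_mono) auto
  ultimately show ?thesis
    using Bop_cmult [OF assms(2), of "- K" x] by (simp add: mult_ac)
qed

text \<open>The factor exp t cancels the term - q, so the difference d of \<mu> and exp t * q
  dominates the time integral of its own convolution with B. The barrier q may change sign, as the
  one in the lower bound does.\<close>

lemma linear_subsolution_le:
  fixes \<mu> q q' :: "real \<Rightarrow> real^'n::finite \<Rightarrow> real" and M b T :: real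
  assumes b: "b \<ge> 0" and M: "M \<ge> 0"
    and mu_cont_x: "\<And>t. t \<in> {0..T} \<Longrightarrow> continuous_on UNIV (\<mu> t)"
    and mu_cont_t: "\<And>x. continuous_on {0..T} (\<lambda>t. \<mu> t x)"
    and mu_bound: "\<And>t x. t \<in> {0..T} \<Longrightarrow> \<bar>\<mu> t x\<bar> \<le> M * (1 + norm x ^ 2) powr b"
    and mu_ge: "\<And>t x. t \<in> {0..T} \<Longrightarrow> \<mu> t x \<ge> u0 x + integral {0..t} (\<lambda>\<tau>. Bop (\<mu> \<tau>) x)"
    and q_cont_x: "\<And>t. t \<in> {0..T} \<Longrightarrow> continuous_on UNIV (q t)"
    and q_bound: "\<And>t x. t \<in> {0..T} \<Longrightarrow> \<bar>q t x\<bar> \<le> M * (1 + norm x ^ 2) powr b"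
    and q_deriv: "\<And>t x. t \<in> {0..T} \<Longrightarrow> ((\<lambda>t. q t x) has_real_derivative q' t x) (at t within {0..T})"
    and q_sub: "\<And>t x. t \<in> {0..T} \<Longrightarrow> q' t x \<le> Bop (q t) x - q t x"
    and q_init: "\<And>x. q 0 x \<le> u0 x"
    and t: "t \<in> {0..T}"
  shows "exp t * q t x \<le> \<mu> t x"
proof -
  define w where "w = (\<lambda>y :: real^'n. (1 + norm y ^ 2) powr b)"
  have w: "poly_growth w" unfolding w_def by (rule poly_growth_weight) (use b in auto)
  have w0: "w y \<ge> 0" for y by (simp add: w_def)
  obtain C where C: "C \<ge> 0" "\<And>x. Bop w x \<le> C * w x"
    using Bop_unit_weight_le [OF b] unfolding w_def by blast
  have q_cont_t: "continuous_on {0..T} (\<lambda>t. q t x)" for x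
    by (rule DERIV_continuous_on) (rule q_deriv)
  have pg: "poly_growth (\<mu> t)" "poly_growth (q t)" if "t \<in> {0..T}" for t
    using that mu_cont_x q_cont_x mu_bound q_bound unfolding w_def [symmetric]
    by (auto intro!: poly_growth_bound [OF _ _ poly_growth_cmult [OF w, of M]] simp: w_def)
  have cB: "continuous_on {0..T} (\<lambda>\<tau>. Bop (\<mu> \<tau>) x)" "continuous_on {0..T} (\<lambda>\<tau>. Bop (q \<tau>) x)" for x
    using mu_bound q_bound
    by (auto intro!: continuous_on_Bop_time [OF _ _ _ poly_growth_cmult [OF w, of M]]
        mu_cont_x mu_cont_t q_cont_x q_cont_t simp: w_def)
  define d where "d = (\<lambda>t x. \<mu> t x - exp t * q t x)"
  define g where "g = (\<lambda>\<tau> x. Bop (\<mu> \<tau>) x - exp \<tau> * Bop (q \<tau>) x)"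
  have "0 \<le> d t x"
  proof (rule integral_inequality_nonneg [where d = d and g = g and T = T and w = w and M = "M + exp T * M" and C = C])
    fix t x assume t: "t \<in> {0..T}"
    have "exp t * q t x \<le> exp T * (M * w x)"
      using q_bound [OF t, of x] t M w0 [of x]
      by (intro order_trans [OF mult_left_mono [of "q t x" "M * w x"] mult_right_mono]) (auto simp: w_def)
    moreover have "\<mu> t x \<ge> - (M * w x)"
      using mu_bound [OF t, of x] by (auto simp: w_def)
    ultimately show "- ((M + exp T * M) * w x) \<le> d t x"
      by (simp add: d_def distrib_right)
    have "exp t * q t x - exp 0 * q 0 x \<le> integral {0..t} (\<lambda>\<tau>. exp \<tau> * Bop (q \<tau>) x)"
    proof (rule has_integral_le)
      show "((\<lambda>\<tau>. exp \<tau> * q \<tau> x + exp \<tau> * q' \<tau> x) has_integral exp t * q t x - exp 0 * q 0 x) {0..t}"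
        using t by (intro fundamental_theorem_of_calculus)
          (auto intro!: derivative_eq_intros DERIV_subset [OF q_deriv]
            simp: has_real_derivative_iff_has_vector_derivative [symmetric])
      show "((\<lambda>\<tau>. exp \<tau> * Bop (q \<tau>) x) has_integral integral {0..t} (\<lambda>\<tau>. exp \<tau> * Bop (q \<tau>) x)) {0..t}"
        using t by (intro integrable_integral integrable_continuous_interval continuous_intros
            continuous_on_subset [OF cB(2)]) auto
      show "exp \<tau> * q \<tau> x + exp \<tau> * q' \<tau> x \<le> exp \<tau> * Bop (q \<tau>) x" if "\<tau> \<in> {0..t}" for \<tau>
      proof -
        have "q \<tau> x + q' \<tau> x \<le> Bop (q \<tau>) x"
          using q_sub [of \<tau> x] that t by simp
        then show ?thesis by (simp only: distrib_left [symmetric] mult_le_cancel_left_pos exp_gt_zero)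
      qed
    qed
    moreover have "integral {0..t} (\<lambda>\<tau>. g \<tau> x)
        = integral {0..t} (\<lambda>\<tau>. Bop (\<mu> \<tau>) x) - integral {0..t} (\<lambda>\<tau>. exp \<tau> * Bop (q \<tau>) x)"
      unfolding g_def using t
      by (intro integral_diff integrable_continuous_interval continuous_intros
          continuous_on_subset [OF cB(1)] continuous_on_subset [OF cB(2)]) auto
    ultimately show "integral {0..t} (\<lambda>\<tau>. g \<tau> x) \<le> d t x"
      using mu_ge [OF t, of x] q_init [of x] by (simp add: d_def)
  next
    fix K \<tau> x assume K: "K \<ge> 0" and \<tau>: "\<tau> \<in> {0..T}" and dK: "\<And>y. - (K * w y) \<le> d \<tau> y"
    have pgd: "poly_growth (d \<tau>)"
      unfolding d_def by (intro poly_growth_diff poly_growth_cmult pg \<tau>)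
    have "g \<tau> x = Bop (d \<tau>) x"
      unfolding g_def d_def using pg [OF \<tau>] by (simp add: Bop_diff poly_growth_cmult Bop_cmult)
    then show "- (C * K * w x) \<le> g \<tau> x"
      using Bop_ge_of_ge [OF pgd w dK K C(2)] by simp
  next
    show "(\<lambda>\<tau>. g \<tau> x) integrable_on {0..T}" for x
      unfolding g_def by (intro integrable_continuous_interval continuous_intros cB)
  qed (use M C t in auto)
  then show ?thesis by (simp add: d_def)
qed

text \<open>The map \<open>s \<mapsto> s powr p\<close> is not Lipschitz at 0, but it lies below its tangent at the positive
  supersolution \<open>z\<close>, so \<open>z - \<mu>\<close> satisfies a linear integral inequality with the coefficient
  \<open>p V z powr (p - 1)\<close>, which \<open>z_V\<close> bounds.\<close>

lemma supersolution_ge: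
  fixes \<mu> z z' :: "real \<Rightarrow> real^'n::finite \<Rightarrow> real" and M b c p T L H :: real
    and V :: "real^'n \<Rightarrow> real \<Rightarrow> real"
  assumes p: "0 < p" "p < 1" and b: "b \<ge> 0" and c: "c \<ge> 0" and M: "M \<ge> 0" and L: "L \<ge> 0" and H: "H \<ge> 0"
    and V_nonneg: "\<And>y t. t \<in> {0..T} \<Longrightarrow> V y t \<ge> 0"
    and V_bound: "\<And>y t. t \<in> {0..T} \<Longrightarrow> V y t \<le> H * (1 + norm y ^ 2) powr c"
    and V_cont_x: "\<And>t. t \<in> {0..T} \<Longrightarrow> continuous_on UNIV (\<lambda>y. V y t)"
    and V_cont_t: "\<And>y. continuous_on {0..T} (\<lambda>t. V y t)"
    and mu_nonneg: "\<And>t x. t \<in> {0..T} \<Longrightarrow> \<mu> t x \<ge> 0"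
    and mu_cont_x: "\<And>t. t \<in> {0..T} \<Longrightarrow> continuous_on UNIV (\<mu> t)"
    and mu_cont_t: "\<And>x. continuous_on {0..T} (\<lambda>t. \<mu> t x)"
    and mu_bound: "\<And>t x. t \<in> {0..T} \<Longrightarrow> \<mu> t x \<le> M * (1 + norm x ^ 2) powr b"
    and mu_eq: "\<And>t x. t \<in> {0..T} \<Longrightarrow> \<mu> t x = u0 x + integral {0..t} (\<lambda>\<tau>. Bop (\<mu> \<tau>) x)
            + integral {0..t} (\<lambda>\<tau>. exp ((1-p)*\<tau>) * Bop (\<lambda>y. V y \<tau> * (\<mu> \<tau> y) powr p) x)"
    and z_pos: "\<And>t x. t \<in> {0..T} \<Longrightarrow> z t x > 0"
    and z_cont_x: "\<And>t. t \<in> {0..T} \<Longrightarrow> continuous_on UNIV (z t)"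
    and z_bound: "\<And>t x. t \<in> {0..T} \<Longrightarrow> z t x \<le> M * (1 + norm x ^ 2) powr b"
    and z_deriv: "\<And>t x. t \<in> {0..T} \<Longrightarrow> ((\<lambda>t. z t x) has_real_derivative z' t x) (at t within {0..T})"
    and z_super: "\<And>t x. t \<in> {0..T} \<Longrightarrow>
      Bop (z t) x - z t x + Bop (\<lambda>y. V y t * z t y powr p) x \<le> z' t x"
    and z_V: "\<And>t y. t \<in> {0..T} \<Longrightarrow> V y t * z t y powr p \<le> L * z t y"
    and z_init: "\<And>x. u0 x \<le> z 0 x"
    and t: "t \<in> {0..T}"
  shows "\<mu> t x \<le> exp t * z t x"
proof -
  define w where "w = (\<lambda>y :: real^'n. (1 + norm y ^ 2) powr b)"
  have w: "poly_growth w" unfolding w_def by (rule poly_growth_weight) (use b in auto)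
  have w1: "w y \<ge> 1" for y
    unfolding w_def using b by (intro ge_one_powr_ge_zero) auto
  then have w0: "w y \<ge> 0" for y by (smt (verit))
  obtain C where C: "C \<ge> 0" "\<And>x. Bop w x \<le> C * w x"
    using Bop_unit_weight_le [OF b] unfolding w_def by blast
  define Z where "Z = (\<lambda>t x. exp t * z t x)"
  define M1 where "M1 = exp T * M"
  have M1: "M1 \<ge> 0" using M by (simp add: M1_def)
  have Zpos: "Z t x > 0" if "t \<in> {0..T}" for t x using z_pos [OF that] by (simp add: Z_def)
  have z_cont_t: "continuous_on {0..T} (\<lambda>t. z t x)" for x
    by (rule DERIV_continuous_on) (rule z_deriv)
  have Z_bound: "Z t x \<le> M1 * w x" if t: "t \<in> {0..T}" for t x
  proof -
    have "exp t * z t x \<le> exp T * (M * w x)"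
      using t z_bound [OF t, of x] z_pos [OF t, of x] by (intro mult_mono) (auto simp: w_def)
    then show ?thesis by (simp add: Z_def M1_def)
  qed
  define N where "N = (\<lambda>\<phi> \<tau> y. V y \<tau> * (\<phi> \<tau> y :: real) powr p)"
  \<comment> \<open>Stated for an arbitrary \<phi> between 0 and a multiple of w, since it is
    applied both to Z and to \<mu>.\<close>
  have N: "poly_growth (N \<phi> \<tau>)" "continuous_on {0..T} (\<lambda>\<tau>. Bop (N \<phi> \<tau>) x)"
      "poly_growth (\<phi> \<tau>)" "continuous_on {0..T} (\<lambda>\<tau>. Bop (\<phi> \<tau>) x)"
    if phi: "\<And>t x. t \<in> {0..T} \<Longrightarrow> \<phi> t x \<ge> 0" "\<And>t x. t \<in> {0..T} \<Longrightarrow> \<phi> t x \<le> K * w x"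
      "\<And>t. t \<in> {0..T} \<Longrightarrow> continuous_on UNIV (\<phi> t)" "\<And>x. continuous_on {0..T} (\<lambda>t. \<phi> t x)"
      and K: "K \<ge> 0" and \<tau>: "\<tau> \<in> {0..T}" for \<phi> :: "real \<Rightarrow> real^'n \<Rightarrow> real" and K \<tau> x
  proof -
    define h where "h = (\<lambda>y :: real^'n. (H * (1 + K)) * (1 + norm y ^ 2) powr (c + b))"
    have h: "poly_growth h"
      unfolding h_def by (intro poly_growth_cmult poly_growth_weight) (use b c in auto)
    have bound: "\<bar>N \<phi> t y\<bar> \<le> h y" if t: "t \<in> {0..T}" for t y
    proof -
      \<comment> \<open>Tangent of the concave power at 1.\<close>
      have "\<phi> t y powr p \<le> 1 + p * (\<phi> t y - 1)"
        using powr_le_tangent [of p "\<phi> t y" 1] p phi(1) [OF t] by simp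
      also have "\<dots> \<le> 1 + \<phi> t y"
        using p phi(1) [OF t, of y] mult_right_mono [of p 1 "\<phi> t y"] by (simp add: right_diff_distrib)
      also have "\<dots> \<le> (1 + K) * w y"
        using phi(2) [OF t, of y] w1 [of y] by (simp add: distrib_right)
      finally have "V y t * \<phi> t y powr p \<le> (H * (1 + norm y ^ 2) powr c) * ((1 + K) * w y)"
        using V_bound [OF t, of y] V_nonneg [OF t, of y] by (intro mult_mono) auto
      also have "\<dots> = h y"
        by (simp add: h_def w_def powr_add)
      finally show ?thesis
        using V_nonneg [OF t, of y] by (simp add: N_def)
    qed
    have c1: "continuous_on UNIV (N \<phi> t)" if t: "t \<in> {0..T}" for t
      unfolding N_def using p phi(1) [OF t]
      by (intro continuous_on_mult V_cont_x [OF t] continuous_on_powr' phi(3) [OF t] continuous_on_const) auto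
    have c2: "continuous_on {0..T} (\<lambda>t. N \<phi> t y)" for y
      unfolding N_def using p phi(1)
      by (intro continuous_on_mult V_cont_t continuous_on_powr' phi(4) continuous_on_const) auto
    show "poly_growth (N \<phi> \<tau>)" by (rule poly_growth_bound [OF c1 [OF \<tau>] bound [OF \<tau>] h])
    show "continuous_on {0..T} (\<lambda>\<tau>. Bop (N \<phi> \<tau>) x)" by (rule continuous_on_Bop_time [OF c1 c2 bound h])
    have bd: "\<bar>\<phi> t y\<bar> \<le> K * w y" if "t \<in> {0..T}" for t y using phi(1,2) [OF that, of y] by simp
    show "poly_growth (\<phi> \<tau>)"
      by (rule poly_growth_bound [OF phi(3) [OF \<tau>] bd [OF \<tau>] poly_growth_cmult [OF w]])
    show "continuous_on {0..T} (\<lambda>\<tau>. Bop (\<phi> \<tau>) x)"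
      by (rule continuous_on_Bop_time [OF phi(3,4) bd poly_growth_cmult [OF w]])
  qed
  have Z_cont_x: "continuous_on UNIV (Z t)" if "t \<in> {0..T}" for t
    unfolding Z_def by (intro continuous_intros z_cont_x that)
  have Z_cont_t: "continuous_on {0..T} (\<lambda>t. Z t x)" for x
    unfolding Z_def by (intro continuous_intros z_cont_t)
  have NZ: "poly_growth (N Z \<tau>)" "continuous_on {0..T} (\<lambda>\<tau>. Bop (N Z \<tau>) x)"
      "poly_growth (Z \<tau>)" "continuous_on {0..T} (\<lambda>\<tau>. Bop (Z \<tau>) x)" if "\<tau> \<in> {0..T}" for \<tau> x
    using N [of Z M1 \<tau>] less_imp_le [OF Zpos] Z_bound Z_cont_x Z_cont_t M1 that by blast+
  have mu_bound': "\<mu> t x \<le> M * w x" if "t \<in> {0..T}" for t x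
    using mu_bound [OF that] by (simp add: w_def)
  have Nmu: "poly_growth (N \<mu> \<tau>)" "continuous_on {0..T} (\<lambda>\<tau>. Bop (N \<mu> \<tau>) x)"
      "poly_growth (\<mu> \<tau>)" "continuous_on {0..T} (\<lambda>\<tau>. Bop (\<mu> \<tau>) x)" if "\<tau> \<in> {0..T}" for \<tau> x
    using N [of \<mu> M \<tau>] mu_nonneg mu_bound' mu_cont_x mu_cont_t M that by blast+
  have T0: "0 \<in> {0..T}" using t by auto
  define d where "d = (\<lambda>t x. Z t x - \<mu> t x)"
  define gZ where "gZ = (\<lambda>\<tau> x. Bop (Z \<tau>) x + exp ((1-p)*\<tau>) * Bop (N Z \<tau>) x)"
  define g where "g = (\<lambda>\<tau> x. gZ \<tau> x - Bop (\<mu> \<tau>) x - exp ((1-p)*\<tau>) * Bop (N \<mu> \<tau>) x)"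
  have cont: "continuous_on {0..T} (\<lambda>\<tau>. gZ \<tau> x)" "continuous_on {0..T} (\<lambda>\<tau>. Bop (\<mu> \<tau>) x)"
    "continuous_on {0..T} (\<lambda>\<tau>. exp ((1-p)*\<tau>) * Bop (N \<mu> \<tau>) x)" for x
    unfolding gZ_def by (intro continuous_intros NZ(2,4) [OF T0] Nmu(2,4) [OF T0])+
  \<comment> \<open>The factor exp (p \<tau>) coming out of Z and the factor exp ((1 - p) \<tau>) of
    the equation combine to exp \<tau>.\<close>
  have zN: "N Z \<tau> y = exp (p * \<tau>) * (V y \<tau> * z \<tau> y powr p)" if "\<tau> \<in> {0..T}" for \<tau> y
    using z_pos [OF that, of y] by (simp add: N_def Z_def powr_mult exp_powr_real mult_ac)
  have "0 \<le> d t x"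
  proof (rule integral_inequality_nonneg [where d = d and g = g and T = T and w = w and M = M and C = "C * (1 + L)"])
    fix t x assume t: "t \<in> {0..T}"
    show "- (M * w x) \<le> d t x"
      using mu_bound' [OF t, of x] Zpos [OF t, of x] by (simp add: d_def)
    have "integral {0..t} (\<lambda>\<tau>. gZ \<tau> x) \<le> Z t x - Z 0 x"
    proof (rule has_integral_le)
      show "((\<lambda>\<tau>. exp \<tau> * z \<tau> x + exp \<tau> * z' \<tau> x) has_integral Z t x - Z 0 x) {0..t}"
        unfolding Z_def using t by (intro fundamental_theorem_of_calculus)
          (auto intro!: derivative_eq_intros DERIV_subset [OF z_deriv]
            simp: has_real_derivative_iff_has_vector_derivative [symmetric])
      show "((\<lambda>\<tau>. gZ \<tau> x) has_integral integral {0..t} (\<lambda>\<tau>. gZ \<tau> x)) {0..t}"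
        using t by (intro integrable_integral integrable_continuous_interval
            continuous_on_subset [OF cont(1)]) auto
      show "gZ \<tau> x \<le> exp \<tau> * z \<tau> x + exp \<tau> * z' \<tau> x" if "\<tau> \<in> {0..t}" for \<tau>
      proof -
        have \<tau>: "\<tau> \<in> {0..T}" using that t by auto
        have eZ: "(\<lambda>y. exp (- \<tau>) * Z \<tau> y) = z \<tau>"
          by (simp add: Z_def fun_eq_iff exp_minus)
        have "Bop (z \<tau>) x = exp (- \<tau>) * Bop (Z \<tau>) x"
          using Bop_cmult [OF NZ(3) [OF \<tau>], of "exp (- \<tau>)" x] by (simp only: eZ)
        then have 1: "Bop (Z \<tau>) x = exp \<tau> * Bop (z \<tau>) x" by (simp add: exp_minus)
        have eN: "(\<lambda>y. exp (- (p * \<tau>)) * N Z \<tau> y) = (\<lambda>y. V y \<tau> * z \<tau> y powr p)"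
          by (simp add: zN [OF \<tau>] fun_eq_iff exp_minus)
        have "Bop (\<lambda>y. V y \<tau> * z \<tau> y powr p) x = exp (- (p * \<tau>)) * Bop (N Z \<tau>) x"
          using Bop_cmult [OF NZ(1) [OF \<tau>], of "exp (- (p * \<tau>))" x] by (simp only: eN)
        then have "exp \<tau> * Bop (\<lambda>y. V y \<tau> * z \<tau> y powr p) x = exp ((1 - p) * \<tau>) * Bop (N Z \<tau>) x"
          by (simp add: mult.assoc [symmetric] exp_add [symmetric] algebra_simps)
        then have "gZ \<tau> x = exp \<tau> * (Bop (z \<tau>) x + Bop (\<lambda>y. V y \<tau> * z \<tau> y powr p) x)"
          by (simp add: gZ_def 1 distrib_left)
        also have "\<dots> \<le> exp \<tau> * (z \<tau> x + z' \<tau> x)"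
          using z_super [OF \<tau>, of x] by simp
        finally show ?thesis by (simp add: distrib_left)
      qed
    qed
    moreover have "integral {0..t} (\<lambda>\<tau>. g \<tau> x)
        = integral {0..t} (\<lambda>\<tau>. gZ \<tau> x) - integral {0..t} (\<lambda>\<tau>. Bop (\<mu> \<tau>) x)
          - integral {0..t} (\<lambda>\<tau>. exp ((1-p)*\<tau>) * Bop (N \<mu> \<tau>) x)"
    proof -
      have "(\<lambda>\<tau>. gZ \<tau> x) integrable_on {0..t}" "(\<lambda>\<tau>. Bop (\<mu> \<tau>) x) integrable_on {0..t}"
        "(\<lambda>\<tau>. exp ((1-p)*\<tau>) * Bop (N \<mu> \<tau>) x) integrable_on {0..t}"
        using t by (auto intro!: integrable_continuous_interval continuous_on_subset [OF cont(1)]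
            continuous_on_subset [OF cont(2)] continuous_on_subset [OF cont(3)])
      then show ?thesis unfolding g_def by (simp add: integral_diff integrable_diff)
    qed
    ultimately show "integral {0..t} (\<lambda>\<tau>. g \<tau> x) \<le> d t x"
      using mu_eq [OF t, of x] z_init [of x] by (simp add: d_def N_def Z_def)
  next
    fix K \<tau> x assume K: "K \<ge> 0" and \<tau>: "\<tau> \<in> {0..T}" and dK: "\<And>y. - (K * w y) \<le> d \<tau> y"
    have pgd: "poly_growth (d \<tau>)"
      unfolding d_def by (intro poly_growth_diff NZ Nmu \<tau>)
    have B1: "Bop (Z \<tau>) x - Bop (\<mu> \<tau>) x \<ge> - (C * K * w x)"
      using Bop_ge_of_ge [OF pgd w dK K C(2), of x] NZ(3) [OF \<tau>] Nmu(3) [OF \<tau>] by (simp add: d_def Bop_diff)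
    define D where "D = (\<lambda>y. exp ((1-p)*\<tau>) * (N Z \<tau> y - N \<mu> \<tau> y))"
    have pgD: "poly_growth D"
      unfolding D_def by (intro poly_growth_cmult poly_growth_diff NZ Nmu \<tau>)
    have D: "D y \<ge> - (L * K * w y)" for y
    proof -
      \<comment> \<open>p e is the slope of the source at Z. Its exponentials cancel, so
        \<open>z_V\<close> bounds e by L uniformly in time.\<close>
      define e where "e = exp ((1-p)*\<tau>) * V y \<tau> * Z \<tau> y powr (p - 1)"
      have e0: "e \<ge> 0" using V_nonneg [OF \<tau>, of y] by (simp add: e_def)
      have "e = (V y \<tau> * z \<tau> y powr p) / z \<tau> y"
      proof -
        have "Z \<tau> y powr (p - 1) = exp ((p - 1) * \<tau>) * (z \<tau> y powr p / z \<tau> y)"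
        proof -
          have "z \<tau> y powr (p - 1) = z \<tau> y powr p / z \<tau> y"
            using z_pos [OF \<tau>, of y] by (simp add: powr_diff)
          moreover have "Z \<tau> y powr (p - 1) = exp ((p - 1) * \<tau>) * z \<tau> y powr (p - 1)"
            by (simp add: Z_def powr_mult exp_powr_real mult.commute)
          ultimately show ?thesis by (simp only:)
        qed
        then have "e = (exp ((1 - p) * \<tau>) * exp ((p - 1) * \<tau>)) * (V y \<tau> * z \<tau> y powr p / z \<tau> y)"
          by (simp add: e_def)
        also have "exp ((1 - p) * \<tau>) * exp ((p - 1) * \<tau>) = 1"
          by (simp add: mult_exp_exp algebra_simps)
        finally show ?thesis by simp
      qed
      also have "\<dots> \<le> L"
        using z_V [OF \<tau>, of y] z_pos [OF \<tau>, of y] by (simp add: divide_le_eq)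
      finally have eL: "e \<le> L" .
      have "\<mu> \<tau> y powr p \<le> Z \<tau> y powr p + p * Z \<tau> y powr (p - 1) * (\<mu> \<tau> y - Z \<tau> y)"
        using powr_le_tangent [of p "\<mu> \<tau> y" "Z \<tau> y"] p mu_nonneg [OF \<tau>, of y] Zpos [OF \<tau>, of y] by simp
      then have "p * Z \<tau> y powr (p - 1) * d \<tau> y \<le> Z \<tau> y powr p - \<mu> \<tau> y powr p"
        by (simp add: d_def algebra_simps)
      then have "(exp ((1-p)*\<tau>) * V y \<tau>) * (p * Z \<tau> y powr (p - 1) * d \<tau> y)
          \<le> (exp ((1-p)*\<tau>) * V y \<tau>) * (Z \<tau> y powr p - \<mu> \<tau> y powr p)"
        using V_nonneg [OF \<tau>, of y] by (intro mult_left_mono) auto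
      then have "(p * e) * d \<tau> y \<le> D y"
        by (simp add: D_def N_def e_def algebra_simps)
      moreover have "(p * e) * d \<tau> y \<ge> (p * e) * (- (K * w y))"
        using p e0 dK [of y] by (intro mult_left_mono) auto
      moreover have "(p * e) * (K * w y) \<le> L * (K * w y)"
      proof (rule mult_right_mono)
        have "p * e \<le> 1 * e" using p e0 by (intro mult_right_mono) auto
        with eL show "p * e \<le> L" by simp
      qed (use K w0 [of y] in simp)
      ultimately show ?thesis by (simp add: mult.assoc)
    qed
    have "- (C * (L * K) * w x) \<le> Bop D x"
      by (rule Bop_ge_of_ge [OF pgD w]) (use D L K C in auto)
    moreover have "Bop D x = exp ((1-p)*\<tau>) * (Bop (N Z \<tau>) x - Bop (N \<mu> \<tau>) x)"
      unfolding D_def using NZ(1) [OF \<tau>] Nmu(1) [OF \<tau>] by (simp add: Bop_cmult poly_growth_diff Bop_diff)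
    ultimately show "- (C * (1 + L) * K * w x) \<le> g \<tau> x"
      using B1 by (simp add: g_def gZ_def algebra_simps)
  next
    show "(\<lambda>\<tau>. g \<tau> x) integrable_on {0..T}" for x
      unfolding g_def by (intro integrable_continuous_interval continuous_on_diff cont)
  qed (use M C L t in auto)
  then show ?thesis by (simp add: d_def Z_def)
qed

section \<open>Growth of solutions\<close>

text \<open>A supremum carries information only when the set is bounded. On a large ball this
  follows from compactness, outside it from the growth bound, as the weight is at most
  |x|^(-a).\<close>

lemma bdd_above_wnorm:
  fixes \<phi> :: "real^'n::finite \<Rightarrow> real"
  assumes a: "a \<ge> 0" and R: "R > 0" and phi: "\<phi> \<in> BC a"
  shows "bdd_above (range (\<lambda>x. (R\<^sup>2 + (norm x)\<^sup>2) powr (-a/2) * \<bar>\<phi> x\<bar>))"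
proof -
  obtain C r where cont: "continuous_on UNIV \<phi>"
    and C: "\<And>x. norm x \<ge> r \<Longrightarrow> \<bar>\<phi> x\<bar> \<le> C * norm x powr a"
    using phi unfolding BC_def by blast
  define f where "f = (\<lambda>x. (R\<^sup>2 + (norm x)\<^sup>2) powr (-a/2) * \<bar>\<phi> x\<bar>)"
  define \<rho> where "\<rho> = max r 1"
  have "continuous_on (cball 0 \<rho>) f"
    unfolding f_def using R
    by (intro continuous_intros continuous_on_subset [OF cont]) auto
  then have "bdd_above (f ` cball 0 \<rho>)"
    by (intro bounded_imp_bdd_above compact_imp_bounded compact_continuous_image) auto
  then obtain B where B: "\<And>x. x \<in> cball 0 \<rho> \<Longrightarrow> f x \<le> B"
    unfolding bdd_above_def by blast
  have "f x \<le> max B \<bar>C\<bar>" for x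
  proof (cases "norm x \<le> \<rho>")
    case True
    then show ?thesis using B [of x] by auto
  next
    case False
    then have nx: "norm x > 0" "norm x \<ge> r" by (auto simp: \<rho>_def)
    have "(R\<^sup>2 + (norm x)\<^sup>2) powr (-a/2) \<le> ((norm x)\<^sup>2) powr (-a/2)"
      using a nx by (intro powr_mono2') auto
    also have "((norm x)\<^sup>2) powr (-a/2) = norm x powr (- a)"
      using nx by (simp add: powr_powr flip: powr_numeral)
    finally have "f x \<le> norm x powr (- a) * (\<bar>C\<bar> * norm x powr a)"
      unfolding f_def using C [OF nx(2)]
      by (intro mult_mono) (auto intro: order_trans [OF _ mult_right_mono [OF abs_ge_self]])
    also have "\<dots> = \<bar>C\<bar>" using nx by (simp add: powr_minus)
    finally show ?thesis by simp
  qed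
  then show ?thesis unfolding f_def by (intro bdd_aboveI2)
qed

lemma wnorm_ge:
  fixes \<phi> :: "real^'n::finite \<Rightarrow> real"
  assumes "a \<ge> 0" "R > 0" "\<phi> \<in> BC a"
  shows "(R\<^sup>2 + (norm x)\<^sup>2) powr (-a/2) * \<bar>\<phi> x\<bar> \<le> wnorm R a \<phi>"
  unfolding wnorm_def by (rule cSUP_upper [OF UNIV_I bdd_above_wnorm [OF assms]])

lemma abs_le_wnorm:
  fixes \<phi> :: "real^'n::finite \<Rightarrow> real"
  assumes "a \<ge> 0" "R > 0" "\<phi> \<in> BC a"
  shows "\<bar>\<phi> x\<bar> \<le> wnorm R a \<phi> * (R\<^sup>2 + (norm x)\<^sup>2) powr (a/2)"
proof -
  have one: "(R\<^sup>2 + (norm x)\<^sup>2) powr (-a/2) * (R\<^sup>2 + (norm x)\<^sup>2) powr (a/2) = 1"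
    using assms by (simp add: powr_add [symmetric])
  have "\<bar>\<phi> x\<bar> = ((R\<^sup>2 + (norm x)\<^sup>2) powr (-a/2) * \<bar>\<phi> x\<bar>) * (R\<^sup>2 + (norm x)\<^sup>2) powr (a/2)"
    using one by (simp add: mult_ac)
  also have "\<dots> \<le> wnorm R a \<phi> * (R\<^sup>2 + (norm x)\<^sup>2) powr (a/2)"
    by (intro mult_right_mono wnorm_ge assms) auto
  finally show ?thesis .
qed

lemma wnorm_le:
  fixes \<phi> :: "real^'n::finite \<Rightarrow> real"
  assumes "R > 0" and le: "\<And>x. \<bar>\<phi> x\<bar> \<le> K * (R\<^sup>2 + (norm x)\<^sup>2) powr (a/2)"
  shows "wnorm R a \<phi> \<le> K"
  unfolding wnorm_def
proof (rule cSUP_least)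
  fix x :: "real^'n"
  have one: "(R\<^sup>2 + (norm x)\<^sup>2) powr (-a/2) * (R\<^sup>2 + (norm x)\<^sup>2) powr (a/2) = 1"
    using assms by (simp add: powr_add [symmetric])
  have "(R\<^sup>2 + (norm x)\<^sup>2) powr (-a/2) * \<bar>\<phi> x\<bar>
      \<le> (R\<^sup>2 + (norm x)\<^sup>2) powr (-a/2) * (K * (R\<^sup>2 + (norm x)\<^sup>2) powr (a/2))"
    by (intro mult_left_mono le) auto
  also have "\<dots> = K" using one by (simp add: mult_ac)
  finally show "(R\<^sup>2 + (norm x)\<^sup>2) powr (-a/2) * \<bar>\<phi> x\<bar> \<le> K" .
qed auto

lemma BC_diff:
  assumes "\<phi> \<in> BC a" "\<psi> \<in> BC a" shows "(\<lambda>x. \<phi> x - \<psi> x) \<in> BC a"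
proof -
  obtain C r where 1: "continuous_on UNIV \<phi>" "\<And>x. norm x \<ge> r \<Longrightarrow> \<bar>\<phi> x\<bar> \<le> C * norm x powr a"
    using assms unfolding BC_def by blast
  obtain C' r' where 2: "continuous_on UNIV \<psi>" "\<And>x. norm x \<ge> r' \<Longrightarrow> \<bar>\<psi> x\<bar> \<le> C' * norm x powr a"
    using assms unfolding BC_def by blast
  have "\<bar>\<phi> x - \<psi> x\<bar> \<le> (C + C') * norm x powr a" if "norm x \<ge> max r r'" for x
    using 1(2) [of x] 2(2) [of x] that by (simp add: distrib_right)
  then have "\<exists>C r. \<forall>x. r \<le> norm x \<longrightarrow> \<bar>\<phi> x - \<psi> x\<bar> \<le> C * norm x powr a" by blast
  then show ?thesis
    unfolding BC_def using 1(1) 2(1) by (auto intro!: continuous_intros)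
qed

text \<open>Convergence in the weighted norm implies pointwise continuity, and continuity of the
  norm by the reverse triangle inequality; the latter yields bounds uniform on compact time
  intervals.\<close>

lemma BC_path_continuous:
  fixes \<mu> :: "real \<Rightarrow> real^'n::finite \<Rightarrow> real"
  assumes a: "a \<ge> 0" and BC: "\<And>t. t \<ge> 0 \<Longrightarrow> \<mu> t \<in> BC a"
    and lim: "\<And>t0. t0 \<ge> 0 \<Longrightarrow> ((\<lambda>t. wnorm 1 a (\<lambda>x. \<mu> t x - \<mu> t0 x)) \<longlongrightarrow> 0) (at t0 within {0..})"
  shows "continuous_on {0..} (\<lambda>t. \<mu> t x)" and "continuous_on {0..} (\<lambda>t. wnorm 1 a (\<mu> t))"
proof -
  show "continuous_on {0..} (\<lambda>t. \<mu> t x)"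
    unfolding continuous_on
  proof
    fix t0 :: real assume t0: "t0 \<in> {0..}"
    have "((\<lambda>t. \<mu> t x - \<mu> t0 x) \<longlongrightarrow> 0) (at t0 within {0..})"
    proof (rule Lim_null_comparison)
      show "\<forall>\<^sub>F t in at t0 within {0..}. norm (\<mu> t x - \<mu> t0 x)
          \<le> wnorm 1 a (\<lambda>x. \<mu> t x - \<mu> t0 x) * (1\<^sup>2 + (norm x)\<^sup>2) powr (a/2)"
        unfolding eventually_at_filter real_norm_def
        by (intro always_eventually allI impI abs_le_wnorm [where \<phi> = "\<lambda>x. \<mu> _ x - \<mu> t0 x"] a BC_diff BC)
           (use t0 in auto)
      show "((\<lambda>t. wnorm 1 a (\<lambda>x. \<mu> t x - \<mu> t0 x) * (1\<^sup>2 + (norm x)\<^sup>2) powr (a/2)) \<longlongrightarrow> 0) (at t0 within {0..})"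
        using t0 by (intro tendsto_mult_left_zero lim) simp
    qed
    then show "((\<lambda>t. \<mu> t x) \<longlongrightarrow> \<mu> t0 x) (at t0 within {0..})"
      by (simp add: LIM_zero_iff)
  qed
  show "continuous_on {0..} (\<lambda>t. wnorm 1 a (\<mu> t))"
    unfolding continuous_on
  proof
    fix t0 :: real assume t0: "t0 \<in> {0..}"
    have tri: "wnorm 1 a (\<mu> s) \<le> wnorm 1 a (\<mu> r) + wnorm 1 a (\<lambda>x. \<mu> s x - \<mu> r x)" if "s \<ge> 0" "r \<ge> 0" for s r
    proof (rule wnorm_le)
      fix x
      show "\<bar>\<mu> s x\<bar> \<le> (wnorm 1 a (\<mu> r) + wnorm 1 a (\<lambda>x. \<mu> s x - \<mu> r x)) * (1\<^sup>2 + (norm x)\<^sup>2) powr (a/2)"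
        using abs_le_wnorm [OF a zero_less_one BC [OF that(2)], of x]
          abs_le_wnorm [OF a zero_less_one BC_diff [OF BC [OF that(1)] BC [OF that(2)]], of x]
        unfolding distrib_right by linarith
    qed simp
    have sym: "wnorm 1 a (\<lambda>x. \<mu> s x - \<mu> r x) = wnorm 1 a (\<lambda>x. \<mu> r x - \<mu> s x)" for s r
      unfolding wnorm_def by (simp add: abs_minus_commute)
    have "((\<lambda>t. wnorm 1 a (\<mu> t) - wnorm 1 a (\<mu> t0)) \<longlongrightarrow> 0) (at t0 within {0..})"
    proof (rule Lim_null_comparison)
      show "\<forall>\<^sub>F t in at t0 within {0..}. norm (wnorm 1 a (\<mu> t) - wnorm 1 a (\<mu> t0))
          \<le> wnorm 1 a (\<lambda>x. \<mu> t x - \<mu> t0 x)"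
        unfolding eventually_at_filter
      proof (intro always_eventually allI impI)
        fix t :: real assume "t \<in> {0..}"
        then show "norm (wnorm 1 a (\<mu> t) - wnorm 1 a (\<mu> t0)) \<le> wnorm 1 a (\<lambda>x. \<mu> t x - \<mu> t0 x)"
          using tri [of t t0] tri [of t0 t] sym [of t0 t] t0 by auto
      qed
      show "((\<lambda>t. wnorm 1 a (\<lambda>x. \<mu> t x - \<mu> t0 x)) \<longlongrightarrow> 0) (at t0 within {0..})"
        using t0 by (intro lim) simp
    qed
    then show "((\<lambda>t. wnorm 1 a (\<mu> t)) \<longlongrightarrow> wnorm 1 a (\<mu> t0)) (at t0 within {0..})"
      by (simp add: LIM_zero_iff)
  qed
qed

lemma continuous_bounded_above_interval:
  fixes f :: "real \<Rightarrow> real"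
  assumes "continuous_on {0..} f"
  shows "\<exists>B\<ge>0. \<forall>t\<in>{0..T}. f t \<le> B"
proof -
  have "bdd_above (f ` {0..T})"
    by (intro bounded_imp_bdd_above compact_imp_bounded compact_continuous_image continuous_on_subset [OF assms]) auto
  then obtain B where "\<And>t. t \<in> {0..T} \<Longrightarrow> f t \<le> B"
    unfolding bdd_above_def by blast
  then show ?thesis by (intro exI [of _ "max B 0"]) (auto simp: le_max_iff_disj)
qed

lemma BC_path_bounded:
  fixes \<mu> :: "real \<Rightarrow> real^'n::finite \<Rightarrow> real"
  assumes a: "a \<ge> 0" and BC: "\<And>t. t \<ge> 0 \<Longrightarrow> \<mu> t \<in> BC a"
    and lim: "\<And>t0. t0 \<ge> 0 \<Longrightarrow> ((\<lambda>t. wnorm 1 a (\<lambda>x. \<mu> t x - \<mu> t0 x)) \<longlongrightarrow> 0) (at t0 within {0..})"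
  shows "\<exists>M\<ge>0. \<forall>t\<in>{0..T}. \<forall>x. \<bar>\<mu> t x\<bar> \<le> M * (1 + (norm x)\<^sup>2) powr (a/2)"
proof -
  have "continuous_on {0..} (\<lambda>t. wnorm 1 a (\<mu> t))"
    by (rule BC_path_continuous(2)) (use assms in auto)
  from continuous_bounded_above_interval [OF this]
  obtain B where B: "B \<ge> 0" "\<And>t. t \<in> {0..T} \<Longrightarrow> wnorm 1 a (\<mu> t) \<le> B" by blast
  have "\<bar>\<mu> t x\<bar> \<le> B * (1 + (norm x)\<^sup>2) powr (a/2)" if "t \<in> {0..T}" for t x
    using abs_le_wnorm [OF a zero_less_one BC, of t x] B(2) [OF that] that
    by (auto intro: order_trans [OF _ mult_right_mono])
  with B show ?thesis by blast
qed

section \<open>Lower bound: a polynomial barrier for each final time\<close>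

text \<open>Each T has its own barrier, evaluated only at the origin at time T. On |x|^2 convolution
  acts exactly, on the square of 1 + k t + |x|^2 with a controlled error; the square makes the
  barrier negative far out, so that initially it has to be compared with u0 on a bounded annulus
  only.\<close>

lemma lower_growth:
  fixes \<mu> :: "real \<Rightarrow> real^'n::finite \<Rightarrow> real"
  assumes a: "a \<ge> 0" and c0: "c0 > 0"
    and cont_x: "\<And>t. t \<ge> 0 \<Longrightarrow> continuous_on UNIV (\<mu> t)"
    and cont_t: "\<And>x. continuous_on {0..} (\<lambda>t. \<mu> t x)"
    and bound: "\<And>T. \<exists>M\<ge>0. \<forall>t\<in>{0..T}. \<forall>x. \<bar>\<mu> t x\<bar> \<le> M * (1 + (norm x)\<^sup>2) powr (a/2)"
    and ge: "\<And>t x. t \<ge> 0 \<Longrightarrow> \<mu> t x \<ge> u0 x + integral {0..t} (\<lambda>\<tau>. Bop (\<mu> \<tau>) x)"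
    and u0: "\<And>x. u0 x \<ge> 0" "\<And>x. norm x \<ge> r \<Longrightarrow> u0 x \<ge> c0 * norm x powr a"
  shows "\<exists>c>0. \<forall>\<^sub>F T in at_top. c * T powr (a/2) * exp T \<le> \<mu> T 0"
proof -
  define m2 where "m2 = (\<integral> y. norm y ^ 2 \<partial>(Bmeas :: (real^'n) measure))"
  have m2: "m2 > 0" unfolding m2_def by (rule Bmeas_second_moment_pos)
  obtain K where K: "K \<ge> 0" "\<And>s x :: real^'n. s \<ge> 1 \<Longrightarrow>
     Bop (\<lambda>y. (s + norm y ^ 2) ^ 2) x \<le> (s + norm x ^ 2) ^ 2 + K * (s + norm x ^ 2)"
    using Bop_weight_power_le [of 1, where ?'n = 'n] by (auto simp: numeral_2_eq_2)
  define k where "k = K + 1"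
  have k: "k \<ge> 1" "K \<le> 2 * k" using K by (auto simp: k_def)
  \<comment> \<open>At the origin at time T the barrier is \<kappa> times m2 T - \<delta> T - (1 + k
    T)^2 / (L T). With these \<delta> and L each subtracted term is at most m2 T / 4 for T \<ge> 1.
    What remains is at least m2 T / 2, and \<kappa> times that is c T^(a/2).\<close>
  define \<delta> where "\<delta> = m2 / 4"
  define L where "L = 16 * k\<^sup>2 / m2"
  have pos: "\<delta> > 0" "L > 0" using m2 k by (auto simp: \<delta>_def L_def)
  define c where "c = c0 * \<delta> powr (a/2) * m2 / (2 * L)"
  have c: "c > 0" using c0 pos m2 by (simp add: c_def)
  \<comment> \<open>T \<ge> 1 gives 1 + k T \<le> 2 k T; the second condition puts the points with
    |x|^2 > \<delta> T beyond the radius r, where the lower bound on u0 holds.\<close>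
  have main: "c * T powr (a/2) * exp T \<le> \<mu> T 0" if T: "T \<ge> 1" "\<delta> * T \<ge> r\<^sup>2" for T
  proof -
    have T0: "T > 0" using T by simp
    define \<kappa> where "\<kappa> = c0 * (\<delta> * T) powr (a/2) / (L * T)"
    have kap: "\<kappa> > 0" using c0 pos T0 by (simp add: \<kappa>_def)
    define \<eta> where "\<eta> = \<kappa> / (L * T)"
    have eta: "\<eta> > 0" using kap pos T0 by (simp add: \<eta>_def)
    \<comment> \<open>At time 0 the quartic \<open>q\<close> is positive only on an annulus where \<open>\<delta> T < |y|\<^sup>2 \<le> L T\<close>, and there it lies below
      \<open>c0 |y| powr a\<close>; the scale of \<open>\<kappa>\<close> is forced by this. At time \<open>T\<close> it has grown at the origin to order \<open>T powr (a/2)\<close>.\<close>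
    define q where "q = (\<lambda>t y :: real^'n. \<kappa> * (norm y ^ 2 + (m2 * t - \<delta> * T)) - \<eta> * ((1 + k * t) + norm y ^ 2) ^ 2)"
    define q' where "q' = (\<lambda>t y :: real^'n. \<kappa> * m2 - \<eta> * (2 * k * ((1 + k * t) + norm y ^ 2)))"
    obtain M0 where M0: "M0 \<ge> 0" "\<And>t x. t \<in> {0..T} \<Longrightarrow> \<bar>\<mu> t x\<bar> \<le> M0 * (1 + (norm x)\<^sup>2) powr (a/2)"
      using bound by blast
    define M where "M = M0 + (\<kappa> * (1 + (m2 * T + \<delta> * T)) + \<eta> * (1 + k * T) ^ 2)"
    have M: "M \<ge> M0" "M \<ge> \<kappa> * (1 + (m2 * T + \<delta> * T)) + \<eta> * (1 + k * T) ^ 2"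
      using M0(1) kap eta m2 pos T0 by (auto simp: M_def)
    have sq: "poly_growth (\<lambda>y :: real^'n. norm y ^ 2)"
      by (rule poly_growthI [where C = 1 and j = 1]) (auto intro!: continuous_intros)
    \<comment> \<open>The weight exponent has to cover a/2 for \<mu> and 2 for the quartic.\<close>
    have "exp T * q T 0 \<le> \<mu> T 0"
    proof (rule linear_subsolution_le [where b = "2 + a/2" and M = M and q' = q' and T = T and ?u0.0 = u0])
      fix t and x :: "real^'n" assume t: "t \<in> {0..T}"
      have w: "(1 + norm x ^ 2) powr b' \<le> (1 + norm x ^ 2) powr (2 + a/2)" if "b' \<le> 2 + a/2" for b'
        using that by (intro powr_mono) auto
      show "\<bar>\<mu> t x\<bar> \<le> M * (1 + norm x ^ 2) powr (2 + a/2)"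
        using M0(1) M(1) w [of "a/2"] by (intro order_trans [OF M0(2) [OF t] mult_mono]) auto
      have k0: "1 + k * t \<ge> 1" "k * t \<le> k * T" using t k by auto
      show "\<bar>q t x\<bar> \<le> M * (1 + norm x ^ 2) powr (2 + a/2)"
      proof -
        define X where "X = 1 + norm x ^ 2"
        have X: "X \<ge> 1" by (simp add: X_def)
        then have X2: "X \<le> X\<^sup>2" by (simp add: self_le_power)
        have "\<bar>q t x\<bar> \<le> \<kappa> * \<bar>norm x ^ 2 + (m2 * t - \<delta> * T)\<bar> + \<eta> * ((1 + k * t) + norm x ^ 2) ^ 2"
          unfolding q_def using kap eta by (intro order_trans [OF abs_triangle_ineq4]) (simp add: abs_mult)
        moreover have "\<bar>norm x ^ 2 + (m2 * t - \<delta> * T)\<bar> \<le> (1 + (m2 * T + \<delta> * T)) * X\<^sup>2"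
        proof -
          have "m2 * t \<le> m2 * T" "0 \<le> m2 * t" "0 \<le> \<delta> * T"
            using t m2 pos by auto
          then have "\<bar>norm x ^ 2 + (m2 * t - \<delta> * T)\<bar> \<le> X + (m2 * T + \<delta> * T)"
            unfolding X_def abs_le_iff by (smt (verit) zero_le_power2)
          also have "\<dots> \<le> X\<^sup>2 + (m2 * T + \<delta> * T) * X\<^sup>2"
            using X X2 m2 pos T0 mult_left_mono [of 1 "X\<^sup>2" "m2 * T + \<delta> * T"] by (intro add_mono) auto
          finally show ?thesis by (simp add: distrib_right)
        qed
        moreover have "((1 + k * t) + norm x ^ 2) ^ 2 \<le> ((1 + k * T) * X) ^ 2"
        proof (rule power_mono)
          have "0 \<le> k * T * norm x ^ 2" using k T0 by simp
          then show "(1 + k * t) + norm x ^ 2 \<le> (1 + k * T) * X"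
            using k0 by (simp add: X_def algebra_simps)
          show "0 \<le> (1 + k * t) + norm x ^ 2" using k0 by (smt (verit) zero_le_power2)
        qed
        ultimately have "\<bar>q t x\<bar> \<le> \<kappa> * ((1 + (m2 * T + \<delta> * T)) * X\<^sup>2) + \<eta> * ((1 + k * T) * X) ^ 2"
          using kap eta by (elim order_trans) (intro add_mono mult_left_mono, auto)
        also have "\<dots> = (\<kappa> * (1 + (m2 * T + \<delta> * T)) + \<eta> * (1 + k * T) ^ 2) * X\<^sup>2"
          unfolding power_mult_distrib by (simp only: distrib_right [of _ _ "X\<^sup>2"] mult.assoc)
        also have "\<dots> \<le> M * X powr (2 + a/2)"
        proof (rule mult_mono)
          have "X\<^sup>2 = X powr 2" using X by simp
          also have "\<dots> \<le> X powr (2 + a/2)" using X a by (intro powr_mono) auto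
          finally show "X\<^sup>2 \<le> X powr (2 + a/2)" .
        qed (use M M0 in auto)
        finally show ?thesis by (simp add: X_def)
      qed
      show "((\<lambda>t. q t x) has_real_derivative q' t x) (at t within {0..T})"
        unfolding q_def q'_def by (auto intro!: derivative_eq_intros simp: algebra_simps)
      \<comment> \<open>The quadratic part contributes \<kappa> m2 to both sides. The term k t
        inside the square contributes - 2 k \<eta> (1 + k t + |x|^2) to q', which outweighs what
        convolution adds to the square since \<open>K \<le> 2 * k\<close>.\<close>
      show "q' t x \<le> Bop (q t) x - q t x"
      proof -
        define S where "S = (\<lambda>y :: real^'n. ((1 + k * t) + norm y ^ 2) ^ 2)"
        have S: "poly_growth S" unfolding S_def by (rule poly_growth_weight_power) (use k0 in simp)
        have Sy: "((1 + k * t) + norm y ^ 2) ^ 2 = S y" for y by (simp add: S_def)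
        have "Bop (q t) x = \<kappa> * (Bop (\<lambda>y. norm y ^ 2) x + (m2 * t - \<delta> * T)) - \<eta> * Bop S x"
          unfolding q_def Sy using sq S
          by (simp add: Bop_diff Bop_cmult Bop_add Bop_const poly_growth_add poly_growth_cmult poly_growth_const)
        then have "Bop (q t) x - q t x = \<kappa> * m2 - \<eta> * (Bop S x - S x)"
          unfolding q_def S_def by (simp add: Bop_square_norm m2_def algebra_simps)
        moreover have "\<eta> * (Bop S x - S x) \<le> \<eta> * (2 * k * ((1 + k * t) + norm x ^ 2))"
        proof (rule mult_left_mono)
          have "Bop S x - S x \<le> K * ((1 + k * t) + norm x ^ 2)"
            using K(2) [OF k0(1), of x] by (simp add: S_def)
          also have "\<dots> \<le> 2 * k * ((1 + k * t) + norm x ^ 2)"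
            using k k0 by (intro mult_right_mono) (auto intro: add_nonneg_nonneg)
          finally show "Bop S x - S x \<le> 2 * k * ((1 + k * t) + norm x ^ 2)" .
        qed (use eta in simp)
        ultimately show ?thesis by (simp add: q'_def)
      qed
    next
      fix x :: "real^'n"
      have q0: "q 0 x = \<kappa> * ((norm x ^ 2 - \<delta> * T) - (1 + norm x ^ 2) ^ 2 / (L * T))"
        by (simp add: q_def \<eta>_def algebra_simps)
      show "q 0 x \<le> u0 x"
      proof (cases "\<delta> * T < norm x ^ 2 \<and> norm x ^ 2 \<le> L * T")
        case True
        have "q 0 x \<le> \<kappa> * (L * T)"
          unfolding q0
        proof (rule mult_left_mono)
          have "0 \<le> (1 + norm x ^ 2) ^ 2 / (L * T)" "0 \<le> \<delta> * T" using pos T0 by auto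
          with True show "(norm x ^ 2 - \<delta> * T) - (1 + norm x ^ 2) ^ 2 / (L * T) \<le> L * T" by linarith
        qed (use kap in simp)
        also have "\<dots> = c0 * (\<delta> * T) powr (a/2)" using pos T0 by (simp add: \<kappa>_def)
        also have "\<dots> \<le> c0 * (norm x ^ 2) powr (a/2)"
          using c0 True a pos T0 by (intro mult_left_mono powr_mono2) auto
        also have "(norm x ^ 2) powr (a/2) = norm x powr a"
        proof -
          have "norm x > 0" using True pos T0 by (smt (verit) mult_pos_pos norm_ge_zero power_zero_numeral)
          then show ?thesis by (simp add: powr_powr flip: powr_numeral)
        qed
        also have "c0 * norm x powr a \<le> u0 x"
        proof (rule u0(2))
          have "r\<^sup>2 \<le> norm x ^ 2" using True T by linarith
          then show "r \<le> norm x" by (rule power2_le_imp_le) simp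
        qed
        finally show ?thesis .
      next
        case False
        have "(norm x ^ 2 - \<delta> * T) - (1 + norm x ^ 2) ^ 2 / (L * T) \<le> 0"
        proof (cases "norm x ^ 2 \<le> \<delta> * T")
          case True
          moreover have "0 \<le> (1 + norm x ^ 2) ^ 2 / (L * T)" using pos T0 by auto
          ultimately show ?thesis by linarith
        next
          case False2: False
          then have "L * T \<le> norm x ^ 2" using False by auto
          then have "norm x ^ 2 * (L * T) \<le> (1 + norm x ^ 2) * (1 + norm x ^ 2)"
            using pos T0 by (intro mult_mono) auto
          then have "norm x ^ 2 \<le> (1 + norm x ^ 2) ^ 2 / (L * T)"
            using pos T0 by (simp add: pos_le_divide_eq power2_eq_square)
          moreover have "0 \<le> \<delta> * T" using pos T0 by auto
          ultimately show ?thesis by linarith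
        qed
        then have "q 0 x \<le> 0" unfolding q0 using kap by (simp add: mult_le_0_iff)
        then show ?thesis using u0(1) [of x] by linarith
      qed
    next
      show "continuous_on UNIV (q t)" for t unfolding q_def by (intro continuous_intros)
      show "continuous_on {0..T} (\<lambda>t. \<mu> t x)" for x by (rule continuous_on_subset [OF cont_t]) auto
    qed (use a cont_x ge M M0 T in auto)
    moreover have "c * T powr (a/2) \<le> q T 0"
    proof -
      have "(1 + k * T) ^ 2 \<le> (2 * (k * T)) ^ 2"
        using k T mult_mono [of 1 k 1 T] by (intro power_mono) (auto simp: mult.commute)
      then have "(1 + k * T) ^ 2 / (L * T) \<le> (2 * (k * T)) ^ 2 / (L * T)"
        using pos T0 by (intro divide_right_mono) auto
      also have "\<dots> = m2 * T / 4"
        using T0 m2 k by (simp add: L_def power2_eq_square field_simps)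
      finally have "m2 * T / 2 \<le> m2 * T - \<delta> * T - (1 + k * T) ^ 2 / (L * T)"
        by (simp add: \<delta>_def mult.commute)
      then have "\<kappa> * (m2 * T / 2) \<le> \<kappa> * (m2 * T - \<delta> * T - (1 + k * T) ^ 2 / (L * T))"
        using kap by (intro mult_left_mono) auto
      also have "\<dots> = q T 0" by (simp add: q_def \<eta>_def algebra_simps)
      also have "\<kappa> * (m2 * T / 2) = c * T powr (a/2)"
        using T0 pos by (simp add: c_def \<kappa>_def powr_mult mult_ac)
      finally show ?thesis .
    qed
    ultimately show ?thesis
      by (smt (verit) exp_gt_zero mult.commute mult_left_mono)
  qed
  have "\<forall>\<^sub>F T in at_top. c * T powr (a/2) * exp T \<le> \<mu> T 0"
    using eventually_ge_at_top [of "max 1 (r\<^sup>2 / \<delta>)"]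
  proof eventually_elim
    case (elim T)
    then show ?case using pos by (intro main) (auto simp: pos_divide_le_eq mult.commute)
  qed
  with c show ?thesis by blast
qed

section \<open>Upper bound: a barrier at the critical exponent\<close>

lemma le_powr_of_slow_growth:
  fixes \<zeta> :: "real \<Rightarrow> real"
  assumes cont: "continuous_on {0..} \<zeta>" and \<delta>: "\<delta> > 0"
    and lim: "((\<lambda>t. t powr (-\<delta>) * \<zeta> t) \<longlongrightarrow> 0) at_top"
  shows "\<exists>Z>0. \<forall>t\<ge>0. \<zeta> t \<le> Z * (1 + t) powr \<delta>"
proof -
  have "\<forall>\<^sub>F t in at_top. t powr (-\<delta>) * \<zeta> t < 1"
    using lim by (rule order_tendstoD) simp
  then obtain t1 where t1: "\<And>t. t \<ge> t1 \<Longrightarrow> t powr (-\<delta>) * \<zeta> t < 1"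
    by (auto simp: eventually_at_top_linorder)
  obtain B where B: "B \<ge> 0" "\<And>t. t \<in> {0..max t1 1} \<Longrightarrow> \<zeta> t \<le> B"
    using continuous_bounded_above_interval [OF cont] by blast
  have "\<zeta> t \<le> (B + 1) * (1 + t) powr \<delta>" if t: "t \<ge> 0" for t
  proof (cases "t \<le> max t1 1")
    case True
    then have "\<zeta> t \<le> (B + 1) * 1" using B(1) B(2) [of t] t by auto
    also have "\<dots> \<le> (B + 1) * (1 + t) powr \<delta>"
      using B t \<delta> by (intro mult_left_mono ge_one_powr_ge_zero) auto
    finally show ?thesis .
  next
    case False
    then have t': "t \<ge> t1" "t > 0" by auto
    have "\<zeta> t = t powr \<delta> * (t powr (-\<delta>) * \<zeta> t)" using t' by (simp add: powr_minus)
    also have "\<dots> \<le> t powr \<delta> * 1" using t1 [OF t'(1)] by (intro mult_left_mono) auto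
    also have "\<dots> \<le> (1 + t) powr \<delta>" using t \<delta> by (simp add: powr_mono2)
    also have "\<dots> \<le> (B + 1) * (1 + t) powr \<delta>" using B by (simp add: distrib_right)
    finally show ?thesis .
  qed
  with B show ?thesis by (intro exI [of _ "B + 1"]) auto
qed

text \<open>The time derivative of F Q^b has one summand for each task: differentiating Q^b pays for
  the excess of convolution, and F' = \<epsilon> F / (1 + t) pays for the source. The source scales
  like A^p and F' like A, so a large A suffices.\<close>

lemma upper_growth:
  fixes \<mu> :: "real \<Rightarrow> real^'n::finite \<Rightarrow> real" and V :: "real^'n \<Rightarrow> real \<Rightarrow> real" and \<zeta> :: "real \<Rightarrow> real"
  assumes p: "0 < p" "p < 1" and \<sigma>: "\<sigma> \<ge> 0" and \<epsilon>: "\<epsilon> > 0"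
    and zeta_cont: "continuous_on {0..} \<zeta>" and zeta_pos: "\<And>t. t \<ge> 0 \<Longrightarrow> \<zeta> t > 0"
    and zeta_lim: "\<And>\<delta>. \<delta> > 0 \<Longrightarrow> ((\<lambda>t. t powr (-\<delta>) * \<zeta> t) \<longlongrightarrow> 0) at_top"
    and V: "\<And>x t. V x t = \<zeta> t * (1+t) powr \<nu> * (if \<sigma> = 0 then 1 else norm x powr \<sigma>)"
    and a_def: "a = (\<sigma> + 2 * max (\<nu> + 1) 0) / (1 - p)"
    and nonneg: "\<And>t x. t \<ge> 0 \<Longrightarrow> \<mu> t x \<ge> 0"
    and cont_x: "\<And>t. t \<ge> 0 \<Longrightarrow> continuous_on UNIV (\<mu> t)"
    and cont_t: "\<And>x. continuous_on {0..} (\<lambda>t. \<mu> t x)"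
    and bound: "\<And>T. \<exists>M\<ge>0. \<forall>t\<in>{0..T}. \<forall>x. \<bar>\<mu> t x\<bar> \<le> M * (1 + (norm x)\<^sup>2) powr (a/2)"
    and eq: "\<And>t x. t \<ge> 0 \<Longrightarrow> \<mu> t x = u0 x + integral {0..t} (\<lambda>\<tau>. Bop (\<mu> \<tau>) x)
            + integral {0..t} (\<lambda>\<tau>. exp ((1-p)*\<tau>) * Bop (\<lambda>y. V y \<tau> * (\<mu> \<tau> y) powr p) x)"
  shows "\<exists>A>0. \<exists>k\<ge>1. \<forall>t\<ge>0. \<forall>x.
    \<mu> t x \<le> exp t * (A * (1 + t) powr \<epsilon> * (1 + k * t + norm x ^ 2) powr (a/2))"
proof -
  define b where "b = a / 2"
  have b: "b \<ge> 0" using p \<sigma> by (simp add: b_def a_def)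
  \<comment> \<open>Criticality of a: the powers of Q in the source add up to b.\<close>
  have b_eq: "\<sigma> / 2 + b * p + max (\<nu> + 1) 0 = b"
    using p by (simp add: b_def a_def field_simps)
  obtain k where k: "k \<ge> 1" "\<And>s x :: real^'n. s \<ge> 1 \<Longrightarrow>
     Bop (\<lambda>y. (s + norm y ^ 2) powr b) x \<le> (s + norm x ^ 2) powr b + b * k * (s + norm x ^ 2) powr (b - 1)"
    using Bop_weight_le [OF b, where ?'n = 'n] by blast
  \<comment> \<open>Chosen so that \<open>\<epsilon> * p + \<delta> = \<epsilon>\<close>: the bound
    for F^p \<zeta> then grows like F itself.\<close>
  define \<delta> where "\<delta> = (1 - p) * \<epsilon>"
  have \<delta>: "\<delta> > 0" using p \<epsilon> by (simp add: \<delta>_def)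
  obtain Z0 where Z0: "Z0 > 0" "\<And>t. t \<ge> 0 \<Longrightarrow> \<zeta> t \<le> Z0 * (1 + t) powr \<delta>"
    using le_powr_of_slow_growth [OF zeta_cont \<delta> zeta_lim [OF \<delta>]] by blast
  \<comment> \<open>At time 0 the integral equation reads \<mu> = u0, so this is the growth bound on
    the data.\<close>
  obtain A0 where A0: "A0 \<ge> 0" "\<And>x. \<bar>\<mu> 0 x\<bar> \<le> A0 * (1 + (norm x)\<^sup>2) powr b"
    using bound [of 0] unfolding b_def by auto
  \<comment> \<open>The source requires A^p Z0 (1 + b k) \<le> \<epsilon> A, that is,
    \<open>A powr (1 - p) \<ge> W\<close>.\<close>
  define W where "W = Z0 * (1 + b * k) / \<epsilon>"
  have W: "W > 0" using Z0 b k \<epsilon> by (simp add: W_def add_pos_nonneg)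
  define A where "A = max A0 (W powr (1 / (1 - p)))"
  have A: "A > 0" "A \<ge> A0" using W by (auto simp: A_def less_max_iff_disj)
  have AW: "A powr p * W \<le> A"
  proof -
    have "W = (W powr (1 / (1 - p))) powr (1 - p)" using W p by (simp add: powr_powr)
    also have "\<dots> \<le> A powr (1 - p)" using p by (intro powr_mono2) (auto simp: A_def)
    finally have "A powr p * W \<le> A powr p * A powr (1 - p)" by (intro mult_left_mono) auto
    also have "\<dots> = A" using A by (simp add: powr_add [symmetric])
    finally show ?thesis .
  qed
  define F where "F = (\<lambda>t. A * (1 + t) powr \<epsilon>)"
  define Q where "Q = (\<lambda>t (y :: real^'n). 1 + k * t + norm y ^ 2)"
  have F0: "F t > 0" if "t \<ge> 0" for t using A that by (simp add: F_def)
  have Q1: "Q t y \<ge> 1 + t" if "t \<ge> 0" for t y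
    using mult_right_mono [OF k(1) that] by (simp add: Q_def add_increasing2)
  have Q0: "Q t y > 0" if "t \<ge> 0" for t y using Q1 [OF that, of y] that by linarith
  define G where "G = (\<lambda>t. F t powr p * \<zeta> t / (1 + t))"
  have G0: "G t \<ge> 0" if "t \<ge> 0" for t
    using zeta_pos [OF that] that by (simp add: G_def)
  \<comment> \<open>The factor 1 + b k is the price of applying B to
    \<open>Q powr b\<close>.\<close>
  have GF: "G t * (1 + b * k) \<le> \<epsilon> * F t / (1 + t)" if t: "t \<ge> 0" for t
  proof -
    have "F t powr p * \<zeta> t * (1 + b * k) \<le> F t powr p * (Z0 * (1 + t) powr \<delta>) * (1 + b * k)"
      using b k Z0(2) [OF t] by (intro mult_right_mono mult_left_mono) auto
    also have "\<dots> = (A powr p * W) * \<epsilon> * ((1 + t) powr (\<epsilon> * p) * (1 + t) powr \<delta>)"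
      using A t \<epsilon> by (simp add: F_def powr_mult powr_powr W_def)
    also have "(1 + t) powr (\<epsilon> * p) * (1 + t) powr \<delta> = (1 + t) powr \<epsilon>"
      by (simp add: powr_add [symmetric] \<delta>_def algebra_simps)
    also have "(A powr p * W) * \<epsilon> * (1 + t) powr \<epsilon> \<le> A * \<epsilon> * (1 + t) powr \<epsilon>"
      using AW \<epsilon> by (intro mult_right_mono) auto
    finally have "F t powr p * \<zeta> t * (1 + b * k) \<le> \<epsilon> * F t" by (simp add: F_def mult_ac)
    then have "F t powr p * \<zeta> t * (1 + b * k) / (1 + t) \<le> \<epsilon> * F t / (1 + t)"
      using t by (intro divide_right_mono) auto
    then show ?thesis by (simp add: G_def)
  qed
  \<comment> \<open>The case distinction is there because \<open>0 powr 0\<close> is 0, whereas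
    |x|^0 has to be 1 at the origin.\<close>
  define P where "P = (\<lambda>y :: real^'n. if \<sigma> = 0 then 1 else norm y powr \<sigma>)"
  have P0: "P y \<ge> 0" for y by (simp add: P_def)
  have P_le: "P y \<le> (s + norm y ^ 2) powr (\<sigma> / 2)" if s: "s \<ge> 1" for s y
  proof (cases "\<sigma> = 0")
    case True
    have "s + norm y ^ 2 > 0" using s by (smt (verit) zero_le_power2)
    with True show ?thesis by (simp add: P_def)
  next
    case False
    have "norm y \<le> sqrt (s + norm y ^ 2)" using s by (intro real_le_rsqrt) simp
    then have "norm y powr \<sigma> \<le> sqrt (s + norm y ^ 2) powr \<sigma>"
      using \<sigma> by (intro powr_mono2) auto
    also have "\<dots> = (s + norm y ^ 2) powr (\<sigma> / 2)"
      using s by (simp add: powr_half_sqrt [symmetric] powr_powr)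
    finally show ?thesis using False by (simp add: P_def)
  qed
  have P_cont: "continuous_on UNIV P"
    unfolding P_def using \<sigma> by (cases "\<sigma> = 0") (auto intro!: continuous_intros continuous_on_powr')
  have VP: "V y t = (\<zeta> t * (1 + t) powr \<nu>) * P y" for y t by (simp add: V P_def)
  define z where "z = (\<lambda>t y. F t * Q t y powr b)"
  define z' where "z' = (\<lambda>t y. \<epsilon> * F t / (1 + t) * Q t y powr b + F t * (b * k * Q t y powr (b - 1)))"
  have Vz: "V y t * z t y powr p \<le> G t * Q t y powr b" if t: "t \<ge> 0" for t y
  proof -
    \<comment> \<open>Only 1 / (1 + t) is kept in time. The other factor goes into Q, after its
      exponent is raised to (\<nu> + 1)_+ so that monotonicity in the base applies.\<close>
    have "(1 + t) powr \<nu> = (1 + t) powr (\<nu> + 1) / (1 + t)"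
      using t by (simp add: powr_add)
    also have "\<dots> \<le> Q t y powr (max (\<nu> + 1) 0) / (1 + t)"
    proof (rule divide_right_mono)
      have "(1 + t) powr (\<nu> + 1) \<le> (1 + t) powr (max (\<nu> + 1) 0)" using t by (intro powr_mono) auto
      also have "\<dots> \<le> Q t y powr (max (\<nu> + 1) 0)" using t Q1 [OF t, of y] by (intro powr_mono2) auto
      finally show "(1 + t) powr (\<nu> + 1) \<le> Q t y powr (max (\<nu> + 1) 0)" .
    qed (use t in auto)
    finally have "(1 + t) powr \<nu> * P y \<le> Q t y powr (max (\<nu> + 1) 0) / (1 + t) * Q t y powr (\<sigma> / 2)"
      using P_le [of "1 + k * t" y] k t P0 [of y] by (intro mult_mono) (auto simp: Q_def)
    then have "(\<zeta> t * F t powr p * Q t y powr (b * p)) * ((1 + t) powr \<nu> * P y)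
        \<le> (\<zeta> t * F t powr p * Q t y powr (b * p)) * (Q t y powr (max (\<nu> + 1) 0) / (1 + t) * Q t y powr (\<sigma> / 2))"
      using zeta_pos [OF t] by (intro mult_left_mono) auto
    also have "\<dots> = G t * (Q t y powr (\<sigma> / 2) * Q t y powr (b * p) * Q t y powr (max (\<nu> + 1) 0))"
      by (simp add: G_def)
    also have "Q t y powr (\<sigma> / 2) * Q t y powr (b * p) * Q t y powr (max (\<nu> + 1) 0) = Q t y powr b"
      by (simp only: powr_add [symmetric] b_eq)
    finally show ?thesis
      using F0 [OF t] by (simp add: VP z_def powr_mult powr_powr mult_ac)
  qed
  have main: "\<mu> t x \<le> exp t * z t x" if t: "t \<ge> 0" for t x
  proof -
    obtain M0 where M0: "M0 \<ge> 0" "\<And>s x. s \<in> {0..t} \<Longrightarrow> \<bar>\<mu> s x\<bar> \<le> M0 * (1 + (norm x)\<^sup>2) powr b"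
      using bound unfolding b_def by blast
    have cont_zn: "continuous_on {0..} (\<lambda>t. \<zeta> t * (1 + t) powr \<nu>)"
      by (intro continuous_intros zeta_cont) auto
    obtain H where H: "H \<ge> 0" "\<And>s. s \<in> {0..t} \<Longrightarrow> \<zeta> s * (1 + s) powr \<nu> \<le> H"
      using continuous_bounded_above_interval [OF cont_zn] by blast
    define M where "M = M0 + F t * (1 + k * t) powr b"
    have M: "M \<ge> M0" "M \<ge> F t * (1 + k * t) powr b" using M0 F0 [OF t] by (auto simp: M_def)
    have pgQ: "poly_growth (\<lambda>y. Q s y powr b)" if "s \<ge> 0" for s
      unfolding Q_def by (rule poly_growth_weight) (use k b that in \<open>auto simp: add_pos_nonneg\<close>)
    have zn: "\<zeta> s * (1 + s) powr \<nu> \<ge> 0" if "s \<ge> 0" for s using zeta_pos [OF that] by simp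
    show ?thesis
    proof (rule supersolution_ge [where V = V and p = p and b = b and c = "\<sigma> / 2" and M = M
          and L = \<epsilon> and H = H and T = t and z' = z' and ?u0.0 = u0])
      fix s and y :: "real^'n" assume s': "s \<in> {0..t}"
      then have s: "s \<ge> 0" by simp
      show "V y s \<ge> 0" using zn [OF s] P0 [of y] by (simp add: VP)
      show "V y s \<le> H * (1 + norm y ^ 2) powr (\<sigma> / 2)"
        unfolding VP using H(1) H(2) [OF s'] P_le [of 1 y] P0 [of y] by (intro mult_mono) auto
      show "continuous_on UNIV (\<lambda>y. V y s)"
        unfolding VP by (intro continuous_intros P_cont)
      show "\<mu> s y \<ge> 0" by (rule nonneg [OF s])
      show "continuous_on UNIV (\<mu> s)" by (rule cont_x [OF s])
      have "\<mu> s y \<le> M0 * (1 + norm y ^ 2) powr b" using M0(2) [OF s', of y] by linarith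
      also have "\<dots> \<le> M * (1 + norm y ^ 2) powr b" using M by (intro mult_right_mono) auto
      finally show "\<mu> s y \<le> M * (1 + norm y ^ 2) powr b" .
      show "z s y > 0" using F0 [OF s] Q0 [OF s, of y] by (simp add: z_def)
      show zc: "continuous_on UNIV (z s)"
        unfolding z_def using pgQ [OF s] by (auto simp: poly_growth_def intro!: continuous_intros)
      show "z s y \<le> M * (1 + norm y ^ 2) powr b"
      proof -
        have "F s \<le> F t" unfolding F_def using s s' A \<epsilon> by (intro mult_left_mono powr_mono2) auto
        moreover have "Q s y powr b \<le> ((1 + k * t) * (1 + norm y ^ 2)) powr b"
        proof (rule powr_mono2)
          have "0 \<le> k * t * norm y ^ 2" "k * s \<le> k * t" using k t s' by auto
          then show "Q s y \<le> (1 + k * t) * (1 + norm y ^ 2)"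
            by (simp add: Q_def algebra_simps)
        qed (use b Q0 [OF s, of y] in auto)
        ultimately have "z s y \<le> F t * ((1 + k * t) * (1 + norm y ^ 2)) powr b"
          unfolding z_def using F0 [OF t] by (intro mult_mono) auto
        also have "\<dots> = (F t * (1 + k * t) powr b) * (1 + norm y ^ 2) powr b"
          using k t by (simp add: powr_mult)
        also have "\<dots> \<le> M * (1 + norm y ^ 2) powr b" using M by (intro mult_right_mono) auto
        finally show ?thesis .
      qed
      show "((\<lambda>t. z t y) has_real_derivative z' s y) (at s within {0..t})"
      proof -
        have "((\<lambda>t. F t) has_real_derivative \<epsilon> * F s / (1 + s)) (at s within {0..t})"
          unfolding F_def using s by (auto intro!: derivative_eq_intros simp: powr_diff)
        moreover have "((\<lambda>t. Q t y powr b) has_real_derivative b * k * Q s y powr (b - 1)) (at s within {0..t})"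
          unfolding Q_def using Q0 [OF s, of y] unfolding Q_def by (auto intro!: derivative_eq_intros simp: powr_diff)
        ultimately show ?thesis
          unfolding z_def z'_def by (rule DERIV_mult [THEN DERIV_cong]) (simp add: mult.commute)
      qed
      have BQ: "Bop (\<lambda>y. Q s y powr b) y \<le> Q s y powr b + b * k * Q s y powr (b - 1)"
        unfolding Q_def using k(2) [of "1 + k * s" y] k(1) s by simp
      have BQ': "Bop (\<lambda>y. Q s y powr b) y \<le> (1 + b * k) * Q s y powr b"
      proof -
        have "b * k * Q s y powr (b - 1) \<le> b * k * Q s y powr b"
          using b k Q1 [OF s, of y] s by (intro mult_left_mono powr_mono) auto
        with BQ show ?thesis by (simp add: distrib_right)
      qed
      show "Bop (z s) y - z s y + Bop (\<lambda>y. V y s * z s y powr p) y \<le> z' s y"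
      proof -
        have "Bop (z s) y = F s * Bop (\<lambda>y. Q s y powr b) y"
          unfolding z_def by (rule Bop_cmult [OF pgQ [OF s]])
        also have "\<dots> \<le> F s * (Q s y powr b + b * k * Q s y powr (b - 1))"
          using BQ F0 [OF s] by (intro mult_left_mono) auto
        finally have 1: "Bop (z s) y - z s y \<le> F s * (b * k * Q s y powr (b - 1))"
          by (simp add: z_def distrib_left)
        have pgV: "poly_growth (\<lambda>y. V y s * z s y powr p)"
        proof (rule poly_growth_bound [OF _ _ poly_growth_cmult [OF pgQ [OF s], of "G s"]])
          show "continuous_on UNIV (\<lambda>y. V y s * z s y powr p)"
            unfolding VP using F0 [OF s] Q0 [OF s] p
            by (intro continuous_on_mult continuous_on_powr' zc P_cont continuous_on_const) (auto simp: z_def)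
          show "\<bar>V y s * z s y powr p\<bar> \<le> G s * Q s y powr b" for y
            using Vz [OF s, of y] zn [OF s] P0 [of y] by (simp add: VP)
        qed
        have "Bop (\<lambda>y. V y s * z s y powr p) y \<le> Bop (\<lambda>y. G s * Q s y powr b) y"
          by (intro Bop_mono pgV poly_growth_cmult pgQ s Vz)
        also have "\<dots> = G s * Bop (\<lambda>y. Q s y powr b) y"
          by (rule Bop_cmult [OF pgQ [OF s]])
        also have "\<dots> \<le> G s * ((1 + b * k) * Q s y powr b)"
          using BQ' G0 [OF s] by (intro mult_left_mono) auto
        also have "\<dots> \<le> \<epsilon> * F s / (1 + s) * Q s y powr b"
          unfolding mult.assoc [symmetric] using GF [OF s] by (intro mult_right_mono) auto
        finally show ?thesis using 1 by (simp add: z'_def)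
      qed
      \<comment> \<open>The source is at most z F'/F, and F'/F = \<epsilon> / (1 + s) \<le>
        \<epsilon>; hence the choice L = \<epsilon> in the comparison.\<close>
      show "V y s * z s y powr p \<le> \<epsilon> * z s y"
      proof -
        have "G s * 1 \<le> G s * (1 + b * k)" using G0 [OF s] b k by (intro mult_left_mono) auto
        also have "\<dots> \<le> \<epsilon> * F s / (1 + s)" by (rule GF [OF s])
        also have "\<dots> \<le> \<epsilon> * F s" using s \<epsilon> F0 [OF s] divide_left_mono [of 1 "1 + s" "\<epsilon> * F s"] by simp
        finally have "G s * Q s y powr b \<le> \<epsilon> * F s * Q s y powr b" by (intro mult_right_mono) auto
        with Vz [OF s, of y] show ?thesis by (simp add: z_def)
      qed
    next
      fix y :: "real^'n"
      show "continuous_on {0..t} (\<lambda>s. V y s)"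
        unfolding VP by (intro continuous_on_mult continuous_on_const continuous_on_subset [OF cont_zn]) auto
      show "continuous_on {0..t} (\<lambda>s. \<mu> s y)" by (rule continuous_on_subset [OF cont_t]) auto
      have "u0 y = \<mu> 0 y" using eq [of 0 y] by simp
      also have "\<dots> \<le> A0 * (1 + norm y ^ 2) powr b" using A0(2) [of y] by linarith
      also have "\<dots> \<le> A * (1 + norm y ^ 2) powr b" using A by (intro mult_right_mono) auto
      finally show "u0 y \<le> z 0 y" by (simp add: z_def F_def Q_def)
    qed (use p b \<sigma> M M0 \<epsilon> H t eq in auto)
  qed
  show ?thesis
    using main A k(1) unfolding z_def F_def Q_def b_def by blast
qed

section \<open>From the barriers to the weighted norm of u\<close>

theorem mainTheorem9:
  fixes p \<nu> \<sigma> R l1 l2 :: real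
    and \<zeta> :: "real \<Rightarrow> real"
    and V :: "real^'n::finite \<Rightarrow> real \<Rightarrow> real"
    and u0 :: "real^'n \<Rightarrow> real"
    and u :: "real \<Rightarrow> real^'n \<Rightarrow> real"
  assumes p: "0 < p" "p < 1"
    and sigma: "\<sigma> \<in> Jplus CARD('n)"
    and zeta_cont: "continuous_on {0..} \<zeta>"
    and zeta_pos: "\<forall>t\<ge>0. \<zeta> t > 0"
    and zeta_lim1: "\<forall>\<delta>>0. filterlim (\<lambda>t. t powr \<delta> * \<zeta> t) at_top at_top"
    and zeta_lim2: "\<forall>\<delta>>0. ((\<lambda>t. t powr (-\<delta>) * \<zeta> t) \<longlongrightarrow> 0) at_top"
    and zeta_E: "\<sigma> > 0 \<Longrightarrow> (\<exists>\<epsilon>. 0 < \<epsilon> \<and> \<epsilon> < 1 \<and> (\<lambda>t. \<zeta> t * (1+t) powr \<nu>) \<in> Eclass \<epsilon>)"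
    and V_def: "\<forall>x t. V x t = \<zeta> t * (1+t) powr \<nu> * (if \<sigma> = 0 then 1 else norm x powr \<sigma>)"
    and a_def: "a = (\<sigma> + 2 * max (\<nu> + 1) 0) / (1 - p)"
    and u0_cont: "continuous_on UNIV u0"
    and u0_nonneg: "\<forall>x. u0 x \<ge> 0"
    and l1: "0 < l1" "Liminf at_infinity (\<lambda>x. ereal (norm x powr (-a) * u0 x)) = ereal l1"
    and l2: "0 < l2" "Limsup at_infinity (\<lambda>x. ereal (norm x powr (-a) * u0 x)) = ereal l2"
    and sol: "global_s_solution p a V u0 u"
    and R: "R > 0"
  shows "\<exists>Cl>0. \<forall>\<epsilon>'>0. \<exists>Cu>0. eventually (\<lambda>t.
            Cl * l1 * t powr (a/2) \<le> wnorm R a (u t) \<and>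
            wnorm R a (u t) \<le> Cu * l2 * t powr (a/2 + \<epsilon>')) at_top"
proof -
  define \<mu> where "\<mu> = (\<lambda>t x. exp t * u t x)"
  have sg: "\<sigma> \<ge> 0" using sigma by (auto simp: Jplus_def split: if_splits)
  have a: "a \<ge> 0" using p sg by (simp add: a_def)
  have u_nonneg: "u t x \<ge> 0" if "t \<ge> 0" for t x
    using sol that unfolding global_s_solution_def Let_def by blast
  have BC: "\<mu> t \<in> BC a" if "t \<ge> 0" for t
    using sol that unfolding global_s_solution_def Let_def \<mu>_def by blast
  have lim: "((\<lambda>t. wnorm 1 a (\<lambda>x. \<mu> t x - \<mu> t0 x)) \<longlongrightarrow> 0) (at t0 within {0..})" if "t0 \<ge> 0" for t0
    using sol that unfolding global_s_solution_def Let_def \<mu>_def by blast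
  have eq: "\<mu> t x = u0 x + integral {0..t} (\<lambda>\<tau>. Bop (\<mu> \<tau>) x)
            + integral {0..t} (\<lambda>\<tau>. exp ((1-p)*\<tau>) * Bop (\<lambda>y. V y \<tau> * (\<mu> \<tau> y) powr p) x)"
    if "t \<ge> 0" for t x
    using sol that unfolding global_s_solution_def Let_def \<mu>_def by blast
  have mu_nonneg: "\<mu> t x \<ge> 0" if "t \<ge> 0" for t x using u_nonneg [OF that] by (simp add: \<mu>_def)
  have cont_x: "continuous_on UNIV (\<mu> t)" if "t \<ge> 0" for t using BC [OF that] by (simp add: BC_def)
  have cont_t: "continuous_on {0..} (\<lambda>t. \<mu> t x)" for x by (rule BC_path_continuous(1) [OF a BC lim])
  have bound: "\<exists>M\<ge>0. \<forall>t\<in>{0..T}. \<forall>x. \<bar>\<mu> t x\<bar> \<le> M * (1 + (norm x)\<^sup>2) powr (a/2)" for T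
    by (rule BC_path_bounded [OF a BC lim])
  have u_BC: "u t \<in> BC a" if t: "t \<ge> 0" for t
  proof -
    obtain C r where C: "\<And>x. norm x \<ge> r \<Longrightarrow> \<bar>\<mu> t x\<bar> \<le> C * norm x powr a"
      using BC [OF t] unfolding BC_def by blast
    have u_mu: "u t = (\<lambda>x. exp (- t) * \<mu> t x)" by (simp add: \<mu>_def fun_eq_iff exp_minus)
    have "\<bar>u t x\<bar> \<le> (exp (- t) * C) * norm x powr a" if "norm x \<ge> r" for x
      using mult_left_mono [OF C [OF that], of "exp (- t)"] unfolding u_mu by (simp add: abs_mult mult.assoc)
    moreover have "continuous_on UNIV (u t)"
      unfolding u_mu by (intro continuous_intros cont_x t)
    ultimately show ?thesis unfolding BC_def by blast
  qed
  have "\<exists>Cl>0. \<forall>\<^sub>F t in at_top. Cl * l1 * t powr (a/2) \<le> wnorm R a (u t)"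
  proof -
    have "ereal (l1 / 2) < Liminf at_infinity (\<lambda>x. ereal (norm x powr (-a) * u0 x))"
      using l1 by simp
    then have "\<forall>\<^sub>F x in at_infinity. ereal (l1 / 2) < ereal (norm x powr (-a) * u0 x)"
      by (rule less_LiminfD)
    then obtain r where r: "\<And>x. norm x \<ge> r \<Longrightarrow> l1 / 2 < norm x powr (-a) * u0 x"
      by (auto simp: eventually_at_infinity)
    \<comment> \<open>A radius of at least 1 excludes x = 0, where the two powers of |x| would not
      cancel.\<close>
    have u0_ge: "u0 x \<ge> (l1 / 2) * norm x powr a" if "norm x \<ge> max r 1" for x
    proof -
      have "(l1 / 2) * norm x powr a \<le> (norm x powr (-a) * u0 x) * norm x powr a"
        using r [of x] that by (intro mult_right_mono) auto
      also have "\<dots> = u0 x * (norm x powr (-a) * norm x powr a)" by simp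
      also have "norm x powr (-a) * norm x powr a = 1"
        using that by (auto simp: powr_add [symmetric])
      finally show ?thesis by simp
    qed
    have mu_ge: "\<mu> t x \<ge> u0 x + integral {0..t} (\<lambda>\<tau>. Bop (\<mu> \<tau>) x)" if t: "t \<ge> 0" for t x
    proof -
      have "0 \<le> exp ((1-p)*\<tau>) * Bop (\<lambda>y. V y \<tau> * (\<mu> \<tau> y) powr p) x" if "\<tau> \<in> {0..t}" for \<tau>
        using that zeta_pos by (intro mult_nonneg_nonneg Bop_nonneg) (auto simp: V_def less_imp_le)
      \<comment> \<open>Were the integrand not integrable in time, the integral would be 0 by
        convention.\<close>
      then have "0 \<le> integral {0..t} (\<lambda>\<tau>. exp ((1-p)*\<tau>) * Bop (\<lambda>y. V y \<tau> * (\<mu> \<tau> y) powr p) x)"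
        by (cases "(\<lambda>\<tau>. exp ((1-p)*\<tau>) * Bop (\<lambda>y. V y \<tau> * (\<mu> \<tau> y) powr p) x) integrable_on {0..t}")
           (auto intro!: integral_nonneg simp: not_integrable_integral)
      then show ?thesis using eq [OF t, of x] by linarith
    qed
    obtain c where c: "c > 0" and ev: "\<forall>\<^sub>F T in at_top. c * T powr (a/2) * exp T \<le> \<mu> T 0"
      using lower_growth [where \<mu> = \<mu> and ?u0.0 = u0 and a = a and ?c0.0 = "l1 / 2" and r = "max r 1"]
        a l1 cont_x cont_t bound mu_ge u0_nonneg u0_ge by auto
    \<comment> \<open>The norm is at least the weighted value at x = 0, where the weight is
      (R^2)^(-a/2); l1 is a fixed number and is divided out.\<close>
    define Cl where "Cl = c * (R\<^sup>2) powr (-a/2) / l1"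
    have "Cl > 0" using c l1 R by (simp add: Cl_def)
    moreover have "\<forall>\<^sub>F t in at_top. Cl * l1 * t powr (a/2) \<le> wnorm R a (u t)"
      using ev eventually_ge_at_top [of 0]
    proof eventually_elim
      case (elim t)
      then have "c * t powr (a/2) \<le> u t 0" by (simp add: \<mu>_def mult.commute)
      then have "(R\<^sup>2) powr (-a/2) * (c * t powr (a/2)) \<le> (R\<^sup>2) powr (-a/2) * \<bar>u t 0\<bar>"
        using u_nonneg [OF elim(2), of 0] by (intro mult_left_mono) auto
      also have "\<dots> \<le> wnorm R a (u t)"
        using wnorm_ge [OF a R u_BC [OF elim(2)], of 0] by simp
      finally show ?case using l1 by (simp add: Cl_def mult_ac)
    qed
    ultimately show ?thesis by blast
  qed
  then obtain Cl where Cl: "Cl > 0" "\<forall>\<^sub>F t in at_top. Cl * l1 * t powr (a/2) \<le> wnorm R a (u t)"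
    by blast
  have upper: "\<exists>Cu>0. \<forall>\<^sub>F t in at_top. wnorm R a (u t) \<le> Cu * l2 * t powr (a/2 + \<epsilon>)" if \<epsilon>: "\<epsilon> > 0" for \<epsilon>
  proof -
    have "\<exists>A>0. \<exists>k\<ge>1. \<forall>t\<ge>0. \<forall>x.
        \<mu> t x \<le> exp t * (A * (1 + t) powr \<epsilon> * (1 + k * t + norm x ^ 2) powr (a/2))"
    proof (rule upper_growth)
      show "V x t = \<zeta> t * (1+t) powr \<nu> * (if \<sigma> = 0 then 1 else norm x powr \<sigma>)" for x t
        using V_def by blast
      show "\<zeta> t > 0" if "t \<ge> 0" for t using zeta_pos that by blast
      show "((\<lambda>t. t powr (-\<delta>) * \<zeta> t) \<longlongrightarrow> 0) at_top" if "\<delta> > 0" for \<delta> using zeta_lim2 that by blast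
    qed fact+
    then obtain A k where A: "A > 0" "k \<ge> 1" and le: "\<And>t x. t \<ge> 0 \<Longrightarrow>
        \<mu> t x \<le> exp t * (A * (1 + t) powr \<epsilon> * (1 + k * t + norm x ^ 2) powr (a/2))"
      by blast
    \<comment> \<open>For t \<ge> 1 the product of D t and R^2 + |x|^2 dominates 1 + k t + |x|^2:
      the summand 1 of D provides |x|^2, the summand (1 + k) / R^2 provides (1 + k) t. The factor
      \<open>t powr (a/2)\<close> of the estimate arises here.\<close>
    define D where "D = 1 + (1 + k) / R\<^sup>2"
    have D: "D > 0" using A R by (simp add: D_def add_pos_nonneg)
    define Cu where "Cu = A * 2 powr \<epsilon> * D powr (a/2) / l2"
    have "Cu > 0" using A D l2 by (simp add: Cu_def)
    moreover have "\<forall>\<^sub>F t in at_top. wnorm R a (u t) \<le> Cu * l2 * t powr (a/2 + \<epsilon>)"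
      using eventually_ge_at_top [of 1]
    proof eventually_elim
      case (elim t)
      then have t: "t \<ge> 0" by simp
      show ?case
      proof (rule wnorm_le [OF R])
        fix x :: "real^'n"
        have "u t x \<le> A * (1 + t) powr \<epsilon> * (1 + k * t + norm x ^ 2) powr (a/2)"
          using le [OF t, of x] by (simp add: \<mu>_def)
        also have "\<dots> \<le> A * (2 * t) powr \<epsilon> * ((D * t) * (R\<^sup>2 + norm x ^ 2)) powr (a/2)"
        proof (intro mult_mono powr_mono2)
          have "D * t * (R\<^sup>2 + norm x ^ 2) \<ge> D * t * R\<^sup>2 + 1 * norm x ^ 2"
          proof -
            have "1 * 1 \<le> D * t" using elim A R by (intro mult_mono) (auto simp: D_def)
            then have "1 * norm x ^ 2 \<le> D * t * norm x ^ 2" by (intro mult_right_mono) auto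
            then show ?thesis by (simp add: distrib_left)
          qed
          moreover have "D * t * R\<^sup>2 \<ge> 1 + k * t"
          proof -
            have "D * t * R\<^sup>2 = t * R\<^sup>2 + (1 + k) * t" using R by (simp add: D_def field_simps)
            moreover have "0 \<le> t * R\<^sup>2" using t by simp
            ultimately show ?thesis using elim unfolding distrib_right by linarith
          qed
          ultimately show "1 + k * t + norm x ^ 2 \<le> D * t * (R\<^sup>2 + norm x ^ 2)" by simp
        qed (use A \<epsilon> elim a in auto)
        also have "\<dots> = Cu * l2 * (t powr \<epsilon> * t powr (a/2)) * (R\<^sup>2 + norm x ^ 2) powr (a/2)"
          using t D l2 by (simp add: powr_mult Cu_def)
        also have "t powr \<epsilon> * t powr (a/2) = t powr (a/2 + \<epsilon>)"
          by (simp add: powr_add)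
        finally show "\<bar>u t x\<bar> \<le> Cu * l2 * t powr (a/2 + \<epsilon>) * (R\<^sup>2 + norm x ^ 2) powr (a/2)"
          using u_nonneg [OF t, of x] by simp
      qed
    qed
    ultimately show ?thesis by blast
  qed
  show ?thesis
  proof (rule exI [of _ Cl], intro conjI allI impI)
    fix \<epsilon>' :: real assume "\<epsilon>' > 0"
    then obtain Cu where Cu: "Cu > 0" "\<forall>\<^sub>F t in at_top. wnorm R a (u t) \<le> Cu * l2 * t powr (a/2 + \<epsilon>')"
      using upper by blast
    then show "\<exists>Cu>0. \<forall>\<^sub>F t in at_top. Cl * l1 * t powr (a/2) \<le> wnorm R a (u t) \<and>
        wnorm R a (u t) \<le> Cu * l2 * t powr (a/2 + \<epsilon>')"
      using Cl(2) by (auto intro: eventually_conj)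
  qed (rule Cl(1))
qed

end
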